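(* The Vaidya-Bonner-de Sitter spacetime with $q^2-rm\neq 0$ admits the following geometric structures: (i) $C\cdot C=-\frac{rm-q^2}{r^4}\,Q(g,C)$, and hence $C\cdot har(R)=-\frac{rm-q^2}{r^4}\,Q(g,har(R))$; (ii) $har(R)\cdot C=-\frac{2r^4\lambda+3rm-3q^2}{3r^4}\,Q(g,C)$, and hence $har(R)\cdot har(R)=-\frac{2r^4\lambda+3rm-3q^2}{3r^4}\,Q(g,har(R))$; (iii) $R\cdot R+\beta\, Q(g,C)=Q(S,R)$, where $\beta=\frac{2r^5\lambda m+3r^2m^2-2r^4\lambda q^2-6rmq^2+2q^4}{3r^4(rm-q^2)}$; (iv) its conformal $2$-forms are recurrent for the $1$-form with components $\left(\frac{rm'-(q^2)'}{rm-q^2},\ \frac{q^2}{r^2m-rq^2},\ 0,\ 0\right)$ in the coordinates $(t,r,\theta,\phi)$; (v) it is a spacetime of generalized Roter type and an Einstein manifold of level $3$; (vi) its Ricci tensor is compatible for $R$, $P$, $cir(R)$, $har(R)$ and $C$.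
   Context: The Vaidya-Bonner-de Sitter (VBdS) spacetime is the $4$-dimensional Lorentzian manifold with coordinates $(x^1,x^2,x^3,x^4)=(t,r,\theta,\phi)$ and metric $ds^2=\left(1-\frac{2m(t)}{r}+\frac{q^2(t)}{r^2}-\frac{\lambda r^2}{3}\right)dt^2-2\,dt\,dr-r^2(d\theta^2+\sin^2\theta\, d\phi^2)$, where $\lambda$ is a constant and the mass $m=m(t)$ and charge $q=q(t)$ are smooth functions depending on $t$; $m'=\frac{dm}{dt}$ and $(q^2)'=\frac{d(q^2)}{dt}$. Curvature conventions ($\Gamma$ = Christoffel symbols): $R_{efst}=g_{e\alpha}(\partial_s\Gamma^\alpha_{ft}-\partial_t\Gamma^\alpha_{fs}+\Gamma^\beta_{ft}\Gamma^\alpha_{\beta s}-\Gamma^\beta_{fs}\Gamma^\alpha_{\beta t})$, Ricci tensor $S_{fs}=g^{et}R_{efst}$, scalar curvature $\bar\kappa=g^{fs}S_{fs}$. For symmetric $(0,2)$ tensors $X,Z$ the Kulkarni-Nomizu product is $(X\wedge Z)_{efst}=X_{et}Z_{fs}+X_{fs}Z_{et}-X_{es}Z_{ft}-X_{ft}Z_{es}$. In dimension $4$: conharmonic $har(R)=R-\frac12 g\wedge S$; concircular $cir(R)=R-\frac{\bar\kappa}{24}g\wedge g$; Weyl conformal $C=R-\frac12 g\wedge S+\frac{\bar\kappa}{12}g\wedge g$; projective $P_{efst}=R_{efst}-\frac13(g_{et}S_{fs}-g_{ft}S_{es})$. For a $(0,m)$ tensor $W$, a $(0,4)$ curvature-type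 tensor $L$ (first index raised by $g$) and a symmetric $(0,2)$ tensor $\beta$: $(L\cdot W)_{b_1\cdots b_m rs}=-[L^\alpha{}_{b_1 rs}W_{\alpha b_2\cdots b_m}+\cdots+L^\alpha{}_{b_m rs}W_{b_1\cdots b_{m-1}\alpha}]$ and $Q(\beta,W)_{b_1\cdots b_m rs}=\beta_{sb_1}W_{rb_2\cdots b_m}+\cdots+\beta_{sb_m}W_{b_1\cdots b_{m-1}r}-\beta_{rb_1}W_{sb_2\cdots b_m}-\cdots-\beta_{rb_m}W_{b_1\cdots b_{m-1}s}$. Let $J$ be the $(1,1)$ Ricci operator and $S^i(X,Y)=S^{i-1}(JX,Y)$ for $i\ge 2$, $S^1=S$. The manifold is an Einstein manifold of level $k$ (Ein$(k)$) if $g,S,S^2,\dots,S^k$ are linearly dependent. It is of generalized Roter type if $R=\mathscr R_{11}\,g\wedge g+\mathscr R_{12}\,g\wedge S+\mathscr R_{22}\,S\wedge S+\mathscr R_{13}\,g\wedge S^2+\mathscr R_{23}\,S\wedge S^2+\mathscr R_{33}\,S^2\wedge S^2$ for some scalar functions $\mathscr R_{ij}$. A $(0,2)$ tensor $H$ is compatible for a $(0,4)$ tensor $D$ if the cyclic sum over $e,f,s$ of $H_e{}^d D_{fstd}$ vanishes, with $H_e{}^d=g^{d\alpha}H_{e\alpha}$. The conformal $2$-forms are recurrent for a $1$-form $\Pi$ if the cyclic sum over $e,f,s$ of $\nabla_e C_{fstd}$ equals the cyclic sum over $e,f,s$ of $\Pi_e C_{fstd}$.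
   Formalization: The generalized Roter type claim in (v) is proved only where the charge q is nonzero; where q = 0 and m ≠ 0 it is false (for q = 0 and constant m ≠ 0 the metric is Einstein with nonzero Weyl tensor, so R is not a multiple of g∧g). *)

theory Defs
  imports "HOL-Analysis.Analysis"
begin

text \<open>
  Everything is expressed in one coordinate chart: points are vectors \<open>x :: real^'n\<close>, and a tensor
  field is its component function (point first, then the indices in the order in which they are
  written in the usual index notation). A metric is given by its covariant components.
\<close>

type_synonym 'n tensor2 = "real^'n \<Rightarrow> 'n \<Rightarrow> 'n \<Rightarrow> real"
type_synonym 'n tensor4 = "real^'n \<Rightarrow> 'n \<Rightarrow> 'n \<Rightarrow> 'n \<Rightarrow> 'n \<Rightarrow> real"

definition pd :: "'n::finite \<Rightarrow> (real^'n \<Rightarrow> real) \<Rightarrow> real^'n \<Rightarrow> real" where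
  "pd i f x = deriv (\<lambda>h. f (x + h *\<^sub>R axis i 1)) 0"

text \<open>Smooth functions of one variable, and smooth scalar functions on the chart; both predicates
  are meant for open sets.\<close>

definition smooth_real_on :: "real set \<Rightarrow> (real \<Rightarrow> real) \<Rightarrow> bool" where
  "smooth_real_on I f \<longleftrightarrow> (\<forall>n. \<forall>t\<in>I. (deriv ^^ n) f differentiable (at t))"

primrec ck_on :: "nat \<Rightarrow> (real^'n::finite) set \<Rightarrow> (real^'n \<Rightarrow> real) \<Rightarrow> bool" where
  "ck_on 0 U f \<longleftrightarrow> continuous_on U f"
| "ck_on (Suc k) U f \<longleftrightarrow> (\<forall>x\<in>U. f differentiable (at x)) \<and> (\<forall>i. ck_on k U (pd i f))"

definition smooth_scalar_on :: "(real^'n::finite) set \<Rightarrow> (real^'n \<Rightarrow> real) \<Rightarrow> bool" where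
  "smooth_scalar_on U f \<longleftrightarrow> (\<forall>k. ck_on k U f)"

definition ginv :: "'n::finite tensor2 \<Rightarrow> 'n tensor2" where
  "ginv g x a b = matrix_inv (\<chi> i j. g x i j) $ a $ b"

text \<open>\<open>christoffel g x a b c\<close> is \<open>\<Gamma>\<^sup>a\<^sub>b\<^sub>c\<close>.\<close>

definition christoffel :: "'n::finite tensor2 \<Rightarrow> real^'n \<Rightarrow> 'n \<Rightarrow> 'n \<Rightarrow> 'n \<Rightarrow> real" where
  "christoffel g x a b c = (1/2) * (\<Sum>d\<in>UNIV. ginv g x a d *
     (pd b (\<lambda>y. g y d c) x + pd c (\<lambda>y. g y d b) x - pd d (\<lambda>y. g y b c) x))"

definition riemann :: "'n::finite tensor2 \<Rightarrow> 'n tensor4" where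
  "riemann g x e f s t = (\<Sum>a\<in>UNIV. g x e a *
     (pd s (\<lambda>y. christoffel g y a f t) x - pd t (\<lambda>y. christoffel g y a f s) x
      + (\<Sum>b\<in>UNIV. christoffel g x b f t * christoffel g x a b s
                  - christoffel g x b f s * christoffel g x a b t)))"

definition ricci :: "'n::finite tensor2 \<Rightarrow> 'n tensor2" where
  "ricci g x f s = (\<Sum>e\<in>UNIV. \<Sum>t\<in>UNIV. ginv g x e t * riemann g x e f s t)"

definition scalar_curv :: "'n::finite tensor2 \<Rightarrow> real^'n \<Rightarrow> real" where
  "scalar_curv g x = (\<Sum>f\<in>UNIV. \<Sum>s\<in>UNIV. ginv g x f s * ricci g x f s)"

definition kulkarni_nomizu :: "'n::finite tensor2 \<Rightarrow> 'n tensor2 \<Rightarrow> 'n tensor4" where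
  "kulkarni_nomizu X Z x e f s t =
     X x e t * Z x f s + X x f s * Z x e t - X x e s * Z x f t - X x f t * Z x e s"

text \<open>The numerical coefficients in the next four tensors are those of dimension 4.\<close>

definition conharmonic :: "4 tensor2 \<Rightarrow> 4 tensor4" where
  "conharmonic g x e f s t =
     riemann g x e f s t - (1/2) * kulkarni_nomizu g (ricci g) x e f s t"

definition concircular :: "4 tensor2 \<Rightarrow> 4 tensor4" where
  "concircular g x e f s t =
     riemann g x e f s t - (scalar_curv g x / 24) * kulkarni_nomizu g g x e f s t"

definition weyl :: "4 tensor2 \<Rightarrow> 4 tensor4" where
  "weyl g x e f s t =
     riemann g x e f s t - (1/2) * kulkarni_nomizu g (ricci g) x e f s t
     + (scalar_curv g x / 12) * kulkarni_nomizu g g x e f s t"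

definition projective :: "4 tensor2 \<Rightarrow> 4 tensor4" where
  "projective g x e f s t =
     riemann g x e f s t - (1/3) * (g x e t * ricci g x f s - g x f t * ricci g x e s)"

definition raise_first :: "'n::finite tensor2 \<Rightarrow> 'n tensor4 \<Rightarrow> 'n tensor4" where
  "raise_first g L x a b r s = (\<Sum>e\<in>UNIV. ginv g x a e * L x e b r s)"

text \<open>The tensors \<open>L \<cdot> W\<close> and \<open>Q(\<beta>,W)\<close> for a \<open>(0,4)\<close> tensor \<open>W\<close>; the derivation indices \<open>r\<close>, \<open>s\<close>
  come last.\<close>

definition curv_dot ::
    "'n::finite tensor2 \<Rightarrow> 'n tensor4 \<Rightarrow> 'n tensor4 \<Rightarrow> real^'n \<Rightarrow> 'n \<Rightarrow> 'n \<Rightarrow> 'n \<Rightarrow> 'n \<Rightarrow> 'n \<Rightarrow> 'n \<Rightarrow> real" where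
  "curv_dot g L W x b1 b2 b3 b4 r s = - (\<Sum>a\<in>UNIV.
       raise_first g L x a b1 r s * W x a b2 b3 b4
     + raise_first g L x a b2 r s * W x b1 a b3 b4
     + raise_first g L x a b3 r s * W x b1 b2 a b4
     + raise_first g L x a b4 r s * W x b1 b2 b3 a)"

definition tachibana ::
    "'n::finite tensor2 \<Rightarrow> 'n tensor4 \<Rightarrow> real^'n \<Rightarrow> 'n \<Rightarrow> 'n \<Rightarrow> 'n \<Rightarrow> 'n \<Rightarrow> 'n \<Rightarrow> 'n \<Rightarrow> real" where
  "tachibana \<beta> W x b1 b2 b3 b4 r s =
       \<beta> x s b1 * W x r b2 b3 b4 + \<beta> x s b2 * W x b1 r b3 b4
     + \<beta> x s b3 * W x b1 b2 r b4 + \<beta> x s b4 * W x b1 b2 b3 r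
     - \<beta> x r b1 * W x s b2 b3 b4 - \<beta> x r b2 * W x b1 s b3 b4
     - \<beta> x r b3 * W x b1 b2 s b4 - \<beta> x r b4 * W x b1 b2 b3 s"

text \<open>\<open>ricci_operator g x a b\<close> is \<open>J\<^sup>a\<^sub>b\<close>, where \<open>g(JX,Y) = S(X,Y)\<close>.\<close>

definition ricci_operator :: "'n::finite tensor2 \<Rightarrow> 'n tensor2" where
  "ricci_operator g x a b = (\<Sum>c\<in>UNIV. ginv g x a c * ricci g x c b)"

text \<open>\<open>S\<^sup>i\<close>, with the convention \<open>S\<^sup>0 = g\<close>.\<close>

fun ricci_pow :: "'n::finite tensor2 \<Rightarrow> nat \<Rightarrow> 'n tensor2" where
  "ricci_pow g 0 = g"
| "ricci_pow g (Suc 0) = ricci g"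
| "ricci_pow g (Suc (Suc i)) =
     (\<lambda>x a b. \<Sum>c\<in>UNIV. ricci_operator g x c a * ricci_pow g (Suc i) x c b)"

text \<open>Linear dependence of \<open>g, S, \<dots>, S\<^sup>k\<close> with smooth scalar coefficients that are nowhere
  simultaneously zero; in particular the tensors are linearly dependent at every point.\<close>

definition einstein_level_on :: "nat \<Rightarrow> (real^'n::finite) set \<Rightarrow> 'n tensor2 \<Rightarrow> bool" where
  "einstein_level_on k U g \<longleftrightarrow> (\<exists>c :: nat \<Rightarrow> real^'n \<Rightarrow> real.
     (\<forall>i\<le>k. smooth_scalar_on U (c i)) \<and>
     (\<forall>x\<in>U. \<exists>i\<le>k. c i x \<noteq> 0) \<and>
     (\<forall>x\<in>U. \<forall>a b. (\<Sum>i\<le>k. c i x * ricci_pow g i x a b) = 0))"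

definition generalized_roter_on :: "(real^'n::finite) set \<Rightarrow> 'n tensor2 \<Rightarrow> bool" where
  "generalized_roter_on U g \<longleftrightarrow> (\<exists>R11 R12 R22 R13 R23 R33 :: real^'n \<Rightarrow> real.
     (\<forall>\<rho>\<in>{R11, R12, R22, R13, R23, R33}. smooth_scalar_on U \<rho>) \<and>
     (\<forall>x\<in>U. \<forall>e f s t. riemann g x e f s t =
          R11 x * kulkarni_nomizu g g x e f s t
        + R12 x * kulkarni_nomizu g (ricci g) x e f s t
        + R22 x * kulkarni_nomizu (ricci g) (ricci g) x e f s t
        + R13 x * kulkarni_nomizu g (ricci_pow g 2) x e f s t
        + R23 x * kulkarni_nomizu (ricci g) (ricci_pow g 2) x e f s t
        + R33 x * kulkarni_nomizu (ricci_pow g 2) (ricci_pow g 2) x e f s t))"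

text \<open>\<open>raise_second g H x e d\<close> is \<open>H\<^sub>e\<^sup>d\<close>.\<close>

definition raise_second :: "'n::finite tensor2 \<Rightarrow> 'n tensor2 \<Rightarrow> 'n tensor2" where
  "raise_second g H x e d = (\<Sum>a\<in>UNIV. ginv g x d a * H x e a)"

definition compatible_on ::
    "(real^'n::finite) set \<Rightarrow> 'n tensor2 \<Rightarrow> 'n tensor2 \<Rightarrow> 'n tensor4 \<Rightarrow> bool" where
  "compatible_on U g H D \<longleftrightarrow> (\<forall>x\<in>U. \<forall>e f s t.
     (\<Sum>d\<in>UNIV. raise_second g H x e d * D x f s t d)
   + (\<Sum>d\<in>UNIV. raise_second g H x f d * D x s e t d)
   + (\<Sum>d\<in>UNIV. raise_second g H x s d * D x e f t d) = 0)"

text \<open>\<open>cov_deriv4 g W x e b1 b2 b3 b4\<close> is \<open>\<nabla>\<^sub>e W\<close> with components \<open>b1 b2 b3 b4\<close> for the Levi-Civita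
  connection of \<open>g\<close>.\<close>

definition cov_deriv4 ::
    "'n::finite tensor2 \<Rightarrow> 'n tensor4 \<Rightarrow> real^'n \<Rightarrow> 'n \<Rightarrow> 'n \<Rightarrow> 'n \<Rightarrow> 'n \<Rightarrow> 'n \<Rightarrow> real" where
  "cov_deriv4 g W x e b1 b2 b3 b4 = pd e (\<lambda>y. W y b1 b2 b3 b4) x - (\<Sum>a\<in>UNIV.
       christoffel g x a e b1 * W x a b2 b3 b4
     + christoffel g x a e b2 * W x b1 a b3 b4
     + christoffel g x a e b3 * W x b1 b2 a b4
     + christoffel g x a e b4 * W x b1 b2 b3 a)"

definition conformal_2forms_recurrent_on ::
    "(real^4) set \<Rightarrow> 4 tensor2 \<Rightarrow> (real^4 \<Rightarrow> 4 \<Rightarrow> real) \<Rightarrow> bool" where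
  "conformal_2forms_recurrent_on U g \<omega> \<longleftrightarrow> (\<forall>x\<in>U. \<forall>e f s t d.
     cov_deriv4 g (weyl g) x e f s t d + cov_deriv4 g (weyl g) x f s e t d
       + cov_deriv4 g (weyl g) x s e f t d
   = \<omega> x e * weyl g x f s t d + \<omega> x f * weyl g x s e t d + \<omega> x s * weyl g x e f t d)"

text \<open>Vaidya-Bonner-de Sitter: \<open>x $ 1, x $ 2, x $ 3, x $ 4\<close> are \<open>t, r, \<theta>, \<phi>\<close> (note that \<open>4 = 0\<close> in the
  index type). The term \<open>-2 dt dr\<close> contributes \<open>-1\<close> to each of the two off-diagonal components.\<close>

definition vbds_metric :: "(real \<Rightarrow> real) \<Rightarrow> (real \<Rightarrow> real) \<Rightarrow> real \<Rightarrow> 4 tensor2" where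
  "vbds_metric m q \<Lambda> x i j =
     (if i = 1 \<and> j = 1
        then 1 - 2 * m (x $ 1) / x $ 2 + (q (x $ 1))\<^sup>2 / (x $ 2)\<^sup>2 - \<Lambda> * (x $ 2)\<^sup>2 / 3
      else if i = 1 \<and> j = 2 \<or> i = 2 \<and> j = 1 then -1
      else if i = 3 \<and> j = 3 then - (x $ 2)\<^sup>2
      else if i = 4 \<and> j = 4 then - ((x $ 2)\<^sup>2 * (sin (x $ 3))\<^sup>2)
      else 0)"

text \<open>The part of the chart where \<open>q\<^sup>2 - r m \<noteq> 0\<close>, with \<open>t\<close> ranging over \<open>I\<close>. The longitude \<open>\<phi>\<close> is left
  unrestricted because nothing depends on it; restricting it to an interval yields a subset.\<close>

definition vbds_domain :: "(real \<Rightarrow> real) \<Rightarrow> (real \<Rightarrow> real) \<Rightarrow> real set \<Rightarrow> (real^4) set" where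
  "vbds_domain m q I = {x. x $ 1 \<in> I \<and> 0 < x $ 2 \<and> 0 < x $ 3 \<and> x $ 3 < pi \<and>
     (q (x $ 1))\<^sup>2 - x $ 2 * m (x $ 1) \<noteq> 0}"

end

(*
  Split g = h + k, where h is the part of the metric in the (t,r)-surfaces and k the part on the
  spheres, and let n = dt^2. For any metric A(t,r) dt^2 - 2 dt dr - r^2 dOmega^2 the Riemann tensor
  is a combination of the Kulkarni-Nomizu products h/\h, k/\k, h/\k, n/\k, the Ricci tensor is a
  combination of h, k, n, and the Weyl tensor is a multiple of h/\h + k/\k - h/\k. Under contraction
  with the inverse metric h and k act as complementary projections and n is nilpotent with
  hn = nh = n, kn = 0; moreover n/\h = n/\n = 0. Since L . _, Q(beta, _) and the covariant derivative
  are derivations for /\, every claim reduces to the action on h, k and n and becomes an identity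
  between the few scalar coefficients.
*)

theory Submission
  imports Defs
begin

section \<open>Partial derivatives along the coordinate lines\<close>

text \<open>The scalars of the statement are read off from this splitting. Put w = (rm - q^2)/r^4
  and u = q^2/r^4. Then w is the Weyl coefficient, and the Ricci eigenvalues are \<Lambda> - u on h
  and \<Lambda> + u on k. A curvature tensor without a part n \<and> k acts on combinations of h
  \<and> h, k \<and> k, h \<and> k as Q(g, _) times its own coefficient of h \<and> k; this gives
  the factors in (i) and (ii). In (iii) the terms with n cancel, and the 3w that occurs in Q(g, C)
  becomes the denominator of \<beta>. The 1-form in (iv) is d log(r^3 w), where r^3 makes up for h
  and k not being parallel. For (v), S is annihilated by a cubic with the double root \<Lambda> - u,
  because n is nilpotent, and k is a multiple of (S - (\<Lambda> - u) g)^2 if u is nonzero. Where q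
  = 0, the products of g, S, S^2 are combinations of g \<and> g and g \<and> n alone. These have no
  Weyl part, whereas w does not vanish: this is why the Roter claim is made where q is
  nonzero.\<close>

definition has_pd :: "'n::finite \<Rightarrow> (real^'n \<Rightarrow> real) \<Rightarrow> real^'n \<Rightarrow> real \<Rightarrow> bool" where
  "has_pd i f x D \<longleftrightarrow> ((\<lambda>h. f (x + h *\<^sub>R axis i 1)) has_real_derivative D) (at 0)"

text \<open>\<open>deriv\<close> is a total function and says nothing about existence, so the
  calculus is done with the relation \<open>has_pd\<close> and only its results are transferred to
  \<open>pd\<close>.\<close>

lemma has_pd_imp_pd: "has_pd i f x D \<Longrightarrow> pd i f x = D"
  unfolding has_pd_def pd_def by (rule DERIV_imp_deriv)

lemma eventually_line:
  fixes x :: "real^'n::finite"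
  assumes "open U" "x \<in> U"
  shows "\<forall>\<^sub>F h in nhds 0. x + h *\<^sub>R axis i 1 \<in> U"
proof -
  have "((\<lambda>h::real. x + h *\<^sub>R axis i 1) \<longlongrightarrow> x + 0 *\<^sub>R axis i 1) (nhds 0)"
    by (intro tendsto_intros) (simp add: filterlim_ident)
  then show ?thesis
    using assms by (simp add: tendsto_def)
qed

lemma has_pd_cong:
  assumes "open U" "x \<in> U" "\<And>y. y \<in> U \<Longrightarrow> f y = f' y"
  shows "has_pd i f x D \<longleftrightarrow> has_pd i f' x D"
  unfolding has_pd_def
proof (rule DERIV_cong_ev)
  show "\<forall>\<^sub>F h in nhds 0. f (x + h *\<^sub>R axis i 1) = f' (x + h *\<^sub>R axis i 1)"
    using eventually_line[OF assms(1,2)] by eventually_elim (rule assms(3))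
qed auto

text \<open>Closed forms of the Christoffel symbols and of the Weyl tensor hold only inside the
  chart. Differentiating them takes agreement on a neighbourhood, which openness supplies.\<close>

lemma pd_cong:
  assumes "open U" "x \<in> U" "\<And>y. y \<in> U \<Longrightarrow> f y = f' y"
  shows "pd i f x = pd i f' x"
  unfolding pd_def
proof (rule deriv_cong_ev)
  show "\<forall>\<^sub>F h in nhds 0. f (x + h *\<^sub>R axis i 1) = f' (x + h *\<^sub>R axis i 1)"
    using eventually_line[OF assms(1,2)] by eventually_elim (rule assms(3))
qed auto

lemma has_pd_const: "has_pd i (\<lambda>_. c) x 0"
  by (simp add: has_pd_def)

lemma has_pd_add: "has_pd i f x D \<Longrightarrow> has_pd i f' x D' \<Longrightarrow> has_pd i (\<lambda>y. f y + f' y) x (D + D')"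
  unfolding has_pd_def by (rule DERIV_add)

lemma has_pd_diff: "has_pd i f x D \<Longrightarrow> has_pd i f' x D' \<Longrightarrow> has_pd i (\<lambda>y. f y - f' y) x (D - D')"
  unfolding has_pd_def by (rule DERIV_diff)

lemma has_pd_minus: "has_pd i f x D \<Longrightarrow> has_pd i (\<lambda>y. - f y) x (- D)"
  unfolding has_pd_def by (rule DERIV_minus)

lemma has_pd_mult:
  "has_pd i f x D \<Longrightarrow> has_pd i f' x D' \<Longrightarrow> has_pd i (\<lambda>y. f y * f' y) x (D * f' x + f x * D')"
  unfolding has_pd_def by (auto intro!: derivative_eq_intros)

lemma has_pd_comp:
  assumes "(f has_real_derivative D) (at (x $ j))"
  shows "has_pd i (\<lambda>y. f (y $ j)) x (if i = j then D else 0)"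
proof (cases "i = j")
  case True
  have "((\<lambda>h. f (x $ j + h)) has_real_derivative D * 1) (at 0)"
    by (rule DERIV_chain2[where f = f]) (use assms in \<open>auto intro!: derivative_eq_intros\<close>)
  then show ?thesis
    using True by (simp add: has_pd_def)
next
  case False
  then show ?thesis by (simp add: has_pd_def axis_def)
qed

text \<open>Moving along one axis freezes the other coordinates, so two one-variable derivatives are
  enough to treat a function of t and r.\<close>

lemma has_pd_comp2:
  assumes "((\<lambda>u. F u (x $ 2)) has_real_derivative D1) (at (x $ 1))"
      and "((\<lambda>v. F (x $ 1) v) has_real_derivative D2) (at (x $ 2))"
  shows "has_pd (i::4) (\<lambda>y. F (y $ 1) (y $ 2)) x (if i = 1 then D1 else if i = 2 then D2 else 0)"
proof -
  have 1: "i = 1 \<or> i = 2 \<or> i \<noteq> 1 \<and> i \<noteq> 2" by blast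
  have "has_pd i (\<lambda>y. F (y $ 1) (x $ 2)) x D1" if "i = 1"
    using has_pd_comp[OF assms(1), of i] that by simp
  moreover have "has_pd i (\<lambda>y. F (x $ 1) (y $ 2)) x D2" if "i = 2"
    using has_pd_comp[OF assms(2), of i] that by simp
  ultimately show ?thesis
    using 1 by (auto simp: has_pd_def axis_def)
qed

lemma has_pd_eq: "has_pd i f x D \<Longrightarrow> D = E \<Longrightarrow> has_pd i f x E"
  by simp

lemma has_pd_coord: "has_pd i (\<lambda>y. y $ j) x (if i = j then 1 else 0)"
  by (rule has_pd_comp[of "\<lambda>u. u" 1]) simp

lemma has_pd_sin: "has_pd i f x D \<Longrightarrow> has_pd i (\<lambda>y. sin (f y)) x (cos (f x) * D)"
  unfolding has_pd_def by (auto intro!: derivative_eq_intros)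

lemma has_pd_cos: "has_pd i f x D \<Longrightarrow> has_pd i (\<lambda>y. cos (f y)) x (- sin (f x) * D)"
  unfolding has_pd_def by (auto intro!: derivative_eq_intros)

lemma has_pd_power: "has_pd i f x D \<Longrightarrow> has_pd i (\<lambda>y. f y ^ n) x (of_nat n * f x ^ (n - 1) * D)"
  unfolding has_pd_def by (auto intro!: derivative_eq_intros)

lemma has_pd_divide:
  "has_pd i f x D \<Longrightarrow> has_pd i f' x D' \<Longrightarrow> f' x \<noteq> 0 \<Longrightarrow>
    has_pd i (\<lambda>y. f y / f' y) x ((D * f' x - f x * D') / (f' x * f' x))"
  unfolding has_pd_def by (auto intro!: derivative_eq_intros)

lemmas has_pd_intros = has_pd_const has_pd_coord has_pd_add has_pd_diff has_pd_minus has_pd_mult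
  has_pd_sin has_pd_cos has_pd_power has_pd_divide

text \<open>\<open>matrix_inv\<close> is a choice among two-sided inverses. For square matrices one
  side implies the other, and this determines the choice.\<close>

lemma matrix_inv_eqI:
  fixes B C :: "real^'n::finite^'n"
  assumes "B ** C = mat 1"
  shows "matrix_inv B = C"
proof -
  have CB: "C ** B = mat 1"
    using assms matrix_left_right_inverse by blast
  have "B ** matrix_inv B = mat 1"
    unfolding matrix_inv_def by (rule someI2[of _ C]) (use assms CB in auto)
  then have "C ** (B ** matrix_inv B) = C"
    by simp
  then show ?thesis
    by (simp add: matrix_mul_assoc CB)
qed

section \<open>Smooth scalar functions\<close>

lemma has_pd_differentiable:
  fixes f :: "real^'n::finite \<Rightarrow> real"
  assumes "f differentiable (at x)"
  shows "has_pd i f x (pd i f x)"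
proof -
  obtain f' where "(f has_derivative f') (at (x + 0 *\<^sub>R axis i 1))"
    using assms by (auto simp: differentiable_def)
  moreover have "((\<lambda>h. x + h *\<^sub>R axis i 1) has_derivative (\<lambda>h. h *\<^sub>R axis i 1)) (at (0::real))"
    by (auto intro!: derivative_eq_intros)
  ultimately have "((\<lambda>h. f (x + h *\<^sub>R axis i 1)) has_derivative (\<lambda>h. f' (h *\<^sub>R axis i 1))) (at 0)"
    by (rule has_derivative_compose[rotated])
  then have "(\<lambda>h. f (x + h *\<^sub>R axis i 1)) differentiable (at 0)"
    by (auto simp: differentiable_def)
  then show ?thesis
    unfolding has_pd_def pd_def by (simp add: DERIV_deriv_iff_real_differentiable)
qed

lemma ck_on_cong:
  assumes "open U" "\<And>x. x \<in> U \<Longrightarrow> f x = f' x"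
  shows "ck_on k U f \<longleftrightarrow> ck_on k U f'"
  using assms(2)
proof (induction k arbitrary: f f')
  case 0
  then show ?case by (auto intro: continuous_on_cong)
next
  case (Suc k)
  have "f1 differentiable (at x)"
    if "f2 differentiable (at x)" "\<And>y. y \<in> U \<Longrightarrow> f1 y = f2 y" "x \<in> U" for x f1 f2
    using has_derivative_transform_within_open[of f2 _ x UNIV U f1] that assms(1)
    by (metis differentiable_def)
  then have "(\<forall>x\<in>U. f differentiable (at x)) \<longleftrightarrow> (\<forall>x\<in>U. f' differentiable (at x))"
    using Suc.prems by metis
  moreover have "ck_on k U (pd i f) \<longleftrightarrow> ck_on k U (pd i f')" for i
    by (rule Suc.IH) (rule pd_cong[OF assms(1)], use Suc.prems in auto)
  ultimately show ?case by simp
qed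

text \<open>The derivative of a product contains the factors themselves: they are given in class k+1
  but needed in class k.\<close>

lemma ck_on_SucD: "ck_on (Suc k) U f \<Longrightarrow> ck_on k U f"
proof (induction k arbitrary: f)
  case 0
  then show ?case
    by (auto intro!: continuous_at_imp_continuous_on differentiable_imp_continuous_within)
next
  case (Suc k)
  then show ?case by (meson ck_on.simps(2))
qed

text \<open>\<open>ck_on\<close> recurses through \<open>pd i f\<close>, which equals the closed
  form \<open>D i\<close> on \<open>U\<close> only; \<open>ck_on_cong\<close> bridges the
  gap.\<close>

lemma ck_on_SucI:
  assumes "open U" "\<And>x. x \<in> U \<Longrightarrow> f differentiable (at x)"
    and "\<And>i x. x \<in> U \<Longrightarrow> has_pd i f x (D i x)" "\<And>i. ck_on k U (D i)"
  shows "ck_on (Suc k) U f"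
proof -
  have "ck_on k U (pd i f)" for i
    using ck_on_cong[OF assms(1), of "pd i f" "D i"] has_pd_imp_pd[OF assms(3)] assms(4) by blast
  then show ?thesis using assms(2) by simp
qed

lemma ck_on_const: "open U \<Longrightarrow> ck_on k U (\<lambda>_. c)"
proof (induction k arbitrary: c)
  case (Suc k)
  show ?case
    by (rule ck_on_SucI[where D = "\<lambda>_ _. 0", OF Suc.prems]) (simp_all add: has_pd_const Suc)
qed (simp add: continuous_on_const)

lemma ck_on_add:
  assumes "open U" "ck_on k U f" "ck_on k U f'"
  shows "ck_on k U (\<lambda>x. f x + f' x)"
  using assms(2,3)
proof (induction k arbitrary: f f')
  case (Suc k)
  show ?case
    by (rule ck_on_SucI[where D = "\<lambda>i x. pd i f x + pd i f' x", OF assms(1)])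
      (use Suc in \<open>auto intro!: has_pd_add has_pd_differentiable\<close>)
qed (simp add: continuous_on_add)

lemma ck_on_mult:
  assumes "open U" "ck_on k U f" "ck_on k U f'"
  shows "ck_on k U (\<lambda>x. f x * f' x)"
  using assms(2,3)
proof (induction k arbitrary: f f')
  case (Suc k)
  show ?case
    by (rule ck_on_SucI[where D = "\<lambda>i x. pd i f x * f' x + f x * pd i f' x", OF assms(1)])
      (use Suc.prems in \<open>auto intro!: has_pd_mult has_pd_differentiable ck_on_add[OF assms(1)]
        Suc.IH intro: ck_on_SucD\<close>)
qed (simp add: continuous_on_mult)

lemma ck_on_inverse:
  assumes "open U" "ck_on k U f" "\<And>x. x \<in> U \<Longrightarrow> f x \<noteq> 0"
  shows "ck_on k U (\<lambda>x. inverse (f x))"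
  using assms(2,3)
proof (induction k arbitrary: f)
  case (Suc k)
  note f = Suc.prems(1)[simplified]
  show ?case
  proof (rule ck_on_SucI[OF assms(1)])
    show "(\<lambda>x. inverse (f x)) differentiable (at x)" if "x \<in> U" for x
      using f Suc.prems(2) that by (intro differentiable_inverse) auto
    \<comment> \<open>The derivative is written with products and \<open>inverse\<close> only, the
      sign being a constant factor, so that closure under products and the induction hypothesis
      apply to it.\<close>
    show "has_pd i (\<lambda>x. inverse (f x)) x ((- 1 * pd i f x) * (inverse (f x) * inverse (f x)))"
      if "x \<in> U" for i x
      using has_pd_differentiable[of f x i] f Suc.prems(2) that unfolding has_pd_def
      by (auto intro!: derivative_eq_intros simp: field_simps)
    show "ck_on k U (\<lambda>x. (- 1 * pd i f x) * (inverse (f x) * inverse (f x)))" for i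
      using f Suc.prems(2)
      by (intro ck_on_mult[OF assms(1)] ck_on_const[OF assms(1)] Suc.IH ck_on_SucD[OF Suc.prems(1)]) auto
  qed
qed (auto intro: continuous_on_inverse)

lemma ck_on_nth:
  assumes "open U"
  shows "ck_on k U (\<lambda>x. x $ j)"
proof (cases k)
  case 0
  then show ?thesis by (auto intro: continuous_intros)
next
  case (Suc k')
  show ?thesis
    unfolding Suc
    by (rule ck_on_SucI[where D = "\<lambda>i _. if i = j then 1 else 0", OF assms])
     (auto intro: has_pd_coord[THEN has_pd_eq] ck_on_const assms
         simp: bounded_linear_imp_differentiable[OF bounded_linear_vec_nth])
qed

text \<open>Each differentiation raises the order of the derivative of \<open>f\<close>, so the
  induction must range over all \<open>n\<close>; the function itself is the case n = 0.\<close>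

lemma ck_on_compose_nth:
  assumes "open U" "smooth_real_on J f" "\<And>x. x \<in> U \<Longrightarrow> x $ j \<in> J"
  shows "ck_on k U (\<lambda>x. (deriv ^^ n) f (x $ j))"
proof (induction k arbitrary: n)
  case 0
  have "continuous_on J ((deriv ^^ n) f)"
    using assms(2) by (auto simp: smooth_real_on_def
        intro!: continuous_at_imp_continuous_on differentiable_imp_continuous_within)
  moreover have "(\<lambda>x. x $ j) ` U \<subseteq> J"
    using assms(3) by auto
  ultimately show ?case
    by (auto intro!: continuous_on_compose2[of J _ U "\<lambda>x. x $ j"] continuous_intros)
next
  case (Suc k)
  have d: "(deriv ^^ n) f differentiable (at (x $ j))" if "x \<in> U" for x
    using assms(2,3) that by (auto simp: smooth_real_on_def)
  show ?case
  proof (rule ck_on_SucI[where D = "\<lambda>i x. if i = j then (deriv ^^ Suc n) f (x $ j) else 0", OF assms(1)])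
    fix x assume x: "x \<in> U"
    show "(\<lambda>x. (deriv ^^ n) f (x $ j)) differentiable (at x)"
      using differentiable_compose[OF d[OF x] bounded_linear_imp_differentiable[OF bounded_linear_vec_nth]] .
    show "has_pd i (\<lambda>x. (deriv ^^ n) f (x $ j)) x (if i = j then (deriv ^^ Suc n) f (x $ j) else 0)" for i
      using d[OF x] by (intro has_pd_comp) (simp add: DERIV_deriv_iff_real_differentiable)
  next
    show "ck_on k U (\<lambda>x. if i = j then (deriv ^^ Suc n) f (x $ j) else 0)" for i
      using Suc.IH[of "Suc n"] ck_on_const[OF assms(1)] by (cases "i = j") auto
  qed
qed

lemma smooth_scalar_on_intros:
  assumes "open U"
  shows "smooth_scalar_on U (\<lambda>_. c)"
    and "smooth_scalar_on U (\<lambda>x. x $ j)"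
    and "smooth_scalar_on U f \<Longrightarrow> smooth_scalar_on U f' \<Longrightarrow> smooth_scalar_on U (\<lambda>x. f x + f' x)"
    and "smooth_scalar_on U f \<Longrightarrow> smooth_scalar_on U (\<lambda>x. - f x)"
    and "smooth_scalar_on U f \<Longrightarrow> smooth_scalar_on U f' \<Longrightarrow> smooth_scalar_on U (\<lambda>x. f x - f' x)"
    and "smooth_scalar_on U f \<Longrightarrow> smooth_scalar_on U f' \<Longrightarrow> smooth_scalar_on U (\<lambda>x. f x * f' x)"
    and "smooth_scalar_on U f \<Longrightarrow> smooth_scalar_on U f' \<Longrightarrow> (\<And>x. x \<in> U \<Longrightarrow> f' x \<noteq> 0) \<Longrightarrow>
      smooth_scalar_on U (\<lambda>x. f x / f' x)"
    and "smooth_scalar_on U f \<Longrightarrow> smooth_scalar_on U (\<lambda>x. f x ^ n)"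
    and "smooth_real_on J F \<Longrightarrow> (\<And>x. x \<in> U \<Longrightarrow> x $ j \<in> J) \<Longrightarrow> smooth_scalar_on U (\<lambda>x. F (x $ j))"
proof -
  show c: "smooth_scalar_on U (\<lambda>_. c)" for c
    by (simp add: smooth_scalar_on_def ck_on_const assms)
  show "smooth_scalar_on U (\<lambda>x. x $ j)"
    by (simp add: smooth_scalar_on_def ck_on_nth assms)
  show add: "smooth_scalar_on U (\<lambda>x. f x + f' x)" if "smooth_scalar_on U f" "smooth_scalar_on U f'" for f f'
    using that by (simp add: smooth_scalar_on_def ck_on_add assms)
  show mult: "smooth_scalar_on U (\<lambda>x. f x * f' x)" if "smooth_scalar_on U f" "smooth_scalar_on U f'" for f f'
    using that by (simp add: smooth_scalar_on_def ck_on_mult assms)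
  show minus: "smooth_scalar_on U (\<lambda>x. - f x)" if "smooth_scalar_on U f" for f
    using mult[OF c[of "-1"] that] by simp
  show "smooth_scalar_on U (\<lambda>x. f x - f' x)" if "smooth_scalar_on U f" "smooth_scalar_on U f'"
    using add[OF that(1) minus[OF that(2)]] by simp
  show "smooth_scalar_on U (\<lambda>x. f x / f' x)"
    if "smooth_scalar_on U f" "smooth_scalar_on U f'" "\<And>x. x \<in> U \<Longrightarrow> f' x \<noteq> 0"
    using mult[OF that(1), of "\<lambda>x. inverse (f' x)"] that
    by (simp add: divide_inverse smooth_scalar_on_def ck_on_inverse assms)
  show "smooth_scalar_on U (\<lambda>x. f x ^ n)" if "smooth_scalar_on U f"
    by (induction n) (simp_all add: c mult that)
  show "smooth_scalar_on U (\<lambda>x. F (x $ j))"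
    if "smooth_real_on J F" "\<And>x. x \<in> U \<Longrightarrow> x $ j \<in> J"
    using ck_on_compose_nth[OF assms that, of _ 0] by (simp add: smooth_scalar_on_def)
qed

section \<open>Derivations and Kulkarni-Nomizu products\<close>

text \<open>As matrices this is X g^-1 Y: the composite of the associated endomorphisms, lowered
  again to a form. All contractions below are expressed by it.\<close>

definition tensor_comp :: "'n::finite tensor2 \<Rightarrow> 'n tensor2 \<Rightarrow> 'n tensor2 \<Rightarrow> 'n tensor2" where
  "tensor_comp g X Y x i j = (\<Sum>a\<in>UNIV. \<Sum>b\<in>UNIV. X x i a * ginv g x a b * Y x b j)"

text \<open>The analogues of \<^const>\<open>curv_dot\<close> and \<^const>\<open>tachibana\<close> for a \<open>(0,2)\<close> tensor. Their values are
  tensor fields that do not depend on the point, so that they can be arguments of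
  \<^const>\<open>kulkarni_nomizu\<close>.\<close>

definition curv_dot2 ::
    "'n::finite tensor2 \<Rightarrow> 'n tensor4 \<Rightarrow> 'n tensor2 \<Rightarrow> real^'n \<Rightarrow> 'n \<Rightarrow> 'n \<Rightarrow> 'n tensor2" where
  "curv_dot2 g L X x r s = (\<lambda>_ b c. - (\<Sum>a\<in>UNIV.
     raise_first g L x a b r s * X x a c + raise_first g L x a c r s * X x b a))"

definition tachibana2 :: "'n::finite tensor2 \<Rightarrow> 'n tensor2 \<Rightarrow> real^'n \<Rightarrow> 'n \<Rightarrow> 'n \<Rightarrow> 'n tensor2" where
  "tachibana2 \<beta> X x r s = (\<lambda>_ b c.
     \<beta> x s b * X x r c + \<beta> x s c * X x b r - \<beta> x r b * X x s c - \<beta> x r c * X x b s)"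

lemma curv_dot_kulkarni_nomizu:
  "curv_dot g L (kulkarni_nomizu X Z) x b1 b2 b3 b4 r s =
     kulkarni_nomizu (curv_dot2 g L X x r s) Z x b1 b2 b3 b4
   + kulkarni_nomizu X (curv_dot2 g L Z x r s) x b1 b2 b3 b4"
  by (simp add: curv_dot_def kulkarni_nomizu_def curv_dot2_def sum.distrib sum_subtractf
      sum_distrib_left sum_distrib_right algebra_simps)

lemma tachibana_kulkarni_nomizu:
  "tachibana \<beta> (kulkarni_nomizu X Z) x b1 b2 b3 b4 r s =
     kulkarni_nomizu (tachibana2 \<beta> X x r s) Z x b1 b2 b3 b4
   + kulkarni_nomizu X (tachibana2 \<beta> Z x r s) x b1 b2 b3 b4"
  by (simp add: tachibana_def kulkarni_nomizu_def tachibana2_def algebra_simps)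

text \<open>After raising and contracting, every term is one composite of Z with X or Y times the
  other factor. The action of a product on h, k, n therefore follows from their multiplication table
  under \<open>tensor_comp\<close>.\<close>

lemma curv_dot2_kulkarni_nomizu:
  assumes "\<And>i j. Z x i j = Z x j i"
  shows "curv_dot2 g (kulkarni_nomizu X Y) Z x r s y b c =
     tensor_comp g Z X x c r * Y x b s + X x b s * tensor_comp g Z Y x c r
   - tensor_comp g Z X x c s * Y x b r - X x b r * tensor_comp g Z Y x c s
   + tensor_comp g Z X x b r * Y x c s + X x c s * tensor_comp g Z Y x b r
   - tensor_comp g Z X x b s * Y x c r - X x c r * tensor_comp g Z Y x b s"
proof -
  have *: "(\<Sum>a\<in>UNIV. raise_first g (kulkarni_nomizu X Y) x a b r s * Z x c a) =
      tensor_comp g Z X x c s * Y x b r + X x b r * tensor_comp g Z Y x c s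
    - tensor_comp g Z X x c r * Y x b s - X x b s * tensor_comp g Z Y x c r" for b c
    by (simp add: raise_first_def kulkarni_nomizu_def tensor_comp_def sum.distrib sum_subtractf
        sum_distrib_left sum_distrib_right algebra_simps)
  \<comment> \<open>Symmetry of \<open>Z\<close> moves the contracted index to the second place in
    both sums, where \<open>*\<close> applies.\<close>
  have "curv_dot2 g L Z x r s y b c = - (\<Sum>a\<in>UNIV. raise_first g L x a b r s * Z x c a)
      - (\<Sum>a\<in>UNIV. raise_first g L x a c r s * Z x b a)" for L
    unfolding curv_dot2_def by (simp add: sum.distrib) (rule sum.cong[OF refl], metis assms)
  then show ?thesis
    by (simp add: *)
qed

lemma curv_dot_cong:
  assumes "\<And>e f s t. L x e f s t = L' x e f s t" "\<And>e f s t. W x e f s t = W' x e f s t"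
  shows "curv_dot g L W x a b c d k l = curv_dot g L' W' x a b c d k l"
  by (simp add: curv_dot_def raise_first_def assms)

lemma curv_dot2_cong:
  assumes "\<And>e f s t. L x e f s t = L' x e f s t"
  shows "curv_dot2 g L X x r s y b c = curv_dot2 g L' X x r s y b c"
  by (simp add: curv_dot2_def raise_first_def assms)

lemma tachibana_cong:
  assumes "\<And>i j. \<beta> x i j = \<beta>' x i j" "\<And>e f s t. W x e f s t = W' x e f s t"
  shows "tachibana \<beta> W x a b c d k l = tachibana \<beta>' W' x a b c d k l"
  by (simp add: tachibana_def assms)

lemma curv_dot_add:
  "curv_dot g L (\<lambda>y e f s t. W y e f s t + W' y e f s t) x a b c d k l =
     curv_dot g L W x a b c d k l + curv_dot g L W' x a b c d k l"
  by (simp add: curv_dot_def sum.distrib algebra_simps)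

lemma curv_dot_cmult:
  "curv_dot g L (\<lambda>y e f s t. u y * W y e f s t) x a b c d k l =
     u x * curv_dot g L W x a b c d k l"
  by (simp add: curv_dot_def sum_distrib_left algebra_simps)

lemma tachibana_add:
  "tachibana \<beta> (\<lambda>y e f s t. W y e f s t + W' y e f s t) x a b c d k l =
     tachibana \<beta> W x a b c d k l + tachibana \<beta> W' x a b c d k l"
  by (simp add: tachibana_def algebra_simps)

lemma tachibana_cmult:
  "tachibana \<beta> (\<lambda>y e f s t. u y * W y e f s t) x a b c d k l =
     u x * tachibana \<beta> W x a b c d k l"
  by (simp add: tachibana_def algebra_simps)

lemma curv_dot2_add:
  "curv_dot2 g (\<lambda>y e f s t. L y e f s t + L' y e f s t) X x r s y b c =
     curv_dot2 g L X x r s y b c + curv_dot2 g L' X x r s y b c"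
  by (simp add: curv_dot2_def raise_first_def sum.distrib algebra_simps)

lemma curv_dot2_cmult:
  "curv_dot2 g (\<lambda>y e f s t. u y * L y e f s t) X x r s y b c = u x * curv_dot2 g L X x r s y b c"
  by (simp add: curv_dot2_def raise_first_def sum.distrib sum_distrib_left sum_distrib_right algebra_simps)

lemma tensor_comp_add_left:
  assumes "\<And>i j. X x i j = a * X1 x i j + b * X2 x i j + c * X3 x i j"
  shows "tensor_comp g X Y x i j =
    a * tensor_comp g X1 Y x i j + b * tensor_comp g X2 Y x i j + c * tensor_comp g X3 Y x i j"
  by (simp add: tensor_comp_def assms sum.distrib sum_distrib_left algebra_simps)

lemma tensor_comp_add_right:
  assumes "\<And>i j. Y x i j = a * Y1 x i j + b * Y2 x i j + c * Y3 x i j"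
  shows "tensor_comp g X Y x i j =
    a * tensor_comp g X Y1 x i j + b * tensor_comp g X Y2 x i j + c * tensor_comp g X Y3 x i j"
  by (simp add: tensor_comp_def assms sum.distrib sum_distrib_left algebra_simps)

text \<open>The left-hand side is one step of the recursion for \<^const>\<open>ricci_pow\<close>.\<close>

lemma sum_ricci_operator:
  assumes "\<And>i j. ginv g x i j = ginv g x j i" "\<And>i j. ricci g x i j = ricci g x j i"
  shows "(\<Sum>c\<in>UNIV. ricci_operator g x c a * X x c b) = tensor_comp g (ricci g) X x a b"
proof -
  have "(\<Sum>c\<in>UNIV. ricci_operator g x c a * X x c b) =
      (\<Sum>c\<in>UNIV. \<Sum>d\<in>UNIV. ricci g x a d * ginv g x d c * X x c b)"
    unfolding ricci_operator_def sum_distrib_right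
    by (intro sum.cong refl) (simp add: assms(1) assms(2)[of a])
  also have "\<dots> = tensor_comp g (ricci g) X x a b"
    unfolding tensor_comp_def by (rule sum.swap)
  finally show ?thesis .
qed

lemma sum_raise_second:
  assumes "\<And>i j. ginv g x i j = ginv g x j i" "\<And>i j. X x i j = X x j i"
  shows "(\<Sum>d\<in>UNIV. raise_second g H x e d * X x f d) = tensor_comp g H X x e f"
proof -
  have "(\<Sum>d\<in>UNIV. raise_second g H x e d * X x f d) =
      (\<Sum>d\<in>UNIV. \<Sum>a\<in>UNIV. H x e a * ginv g x a d * X x d f)"
    unfolding raise_second_def sum_distrib_right
    by (intro sum.cong refl) (simp add: assms(1) assms(2)[of f])
  also have "\<dots> = tensor_comp g H X x e f"
    unfolding tensor_comp_def by (rule sum.swap)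
  finally show ?thesis .
qed

text \<open>The cyclic sum is kept as a tensor because it is linear in \<open>D\<close>;
  compatibility can then be checked on the building blocks.\<close>

definition compat_defect :: "'n::finite tensor2 \<Rightarrow> 'n tensor2 \<Rightarrow> 'n tensor4 \<Rightarrow> 'n tensor4" where
  "compat_defect g H D x e f s t = (\<Sum>d\<in>UNIV. raise_second g H x e d * D x f s t d)
   + (\<Sum>d\<in>UNIV. raise_second g H x f d * D x s e t d)
   + (\<Sum>d\<in>UNIV. raise_second g H x s d * D x e f t d)"

lemma compat_defect_add:
  "compat_defect g H (\<lambda>y e f s t. W y e f s t + W' y e f s t) x e f s t =
     compat_defect g H W x e f s t + compat_defect g H W' x e f s t"
  by (simp add: compat_defect_def sum.distrib algebra_simps)

lemma compat_defect_cmult: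
  "compat_defect g H (\<lambda>y e f s t. u y * W y e f s t) x e f s t = u x * compat_defect g H W x e f s t"
  by (simp add: compat_defect_def sum_distrib_left algebra_simps)

lemma compat_defect_cong:
  "(\<And>e f s t. W x e f s t = W' x e f s t) \<Longrightarrow> compat_defect g H W x e f s t = compat_defect g H W' x e f s t"
  by (simp add: compat_defect_def)

text \<open>The contraction pairs a composite of H with one factor against the other factor. If the
  composites are symmetric, the twelve terms of the cyclic sum cancel in pairs.\<close>

lemma compat_defect_kulkarni_nomizu:
  assumes "\<And>i j. ginv g x i j = ginv g x j i"
    and "\<And>i j. X x i j = X x j i" "\<And>i j. Z x i j = Z x j i"
    and "\<And>i j. tensor_comp g H X x i j = tensor_comp g H X x j i"
        "\<And>i j. tensor_comp g H Z x i j = tensor_comp g H Z x j i"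
  shows "compat_defect g H (kulkarni_nomizu X Z) x e f s t = 0"
proof -
  have *: "(\<Sum>d\<in>UNIV. raise_second g H x e d * kulkarni_nomizu X Z x f s t d) =
      tensor_comp g H X x e f * Z x s t + X x s t * tensor_comp g H Z x e f
    - X x f t * tensor_comp g H Z x e s - tensor_comp g H X x e s * Z x f t" for e f s
    by (simp add: sum_raise_second[where X = X, OF assms(1,2), symmetric] sum_raise_second[where X
        = Z, OF assms(1,3), symmetric]
        kulkarni_nomizu_def sum.distrib sum_subtractf sum_distrib_left sum_distrib_right algebra_simps)
  show ?thesis
    unfolding compat_defect_def *
    using assms(4)[of e f] assms(4)[of e s] assms(4)[of f s]
      assms(5)[of e f] assms(5)[of e s] assms(5)[of f s] by (simp add: algebra_simps)
qed

lemma compatible_on_iff: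
  "compatible_on M g H D \<longleftrightarrow> (\<forall>x\<in>M. \<forall>e f s t. compat_defect g H D x e f s t = 0)"
  by (simp add: compatible_on_def compat_defect_def)

definition cov_deriv2 :: "'n::finite tensor2 \<Rightarrow> 'n tensor2 \<Rightarrow> real^'n \<Rightarrow> 'n \<Rightarrow> 'n tensor2" where
  "cov_deriv2 g X x e = (\<lambda>_ b c. pd e (\<lambda>y. X y b c) x - (\<Sum>a\<in>UNIV.
     christoffel g x a e b * X x a c + christoffel g x a e c * X x b a))"

lemma has_pd_kulkarni_nomizu:
  assumes "\<And>b c. has_pd e (\<lambda>y. X y b c) x (pd e (\<lambda>y. X y b c) x)"
    and "\<And>b c. has_pd e (\<lambda>y. Z y b c) x (pd e (\<lambda>y. Z y b c) x)"
  shows "has_pd e (\<lambda>y. kulkarni_nomizu X Z y b1 b2 b3 b4) x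
    (kulkarni_nomizu (\<lambda>x b c. pd e (\<lambda>y. X y b c) x) Z x b1 b2 b3 b4
     + kulkarni_nomizu X (\<lambda>x b c. pd e (\<lambda>y. Z y b c) x) x b1 b2 b3 b4)"
  unfolding kulkarni_nomizu_def
  by (rule has_pd_eq, (rule has_pd_add has_pd_diff has_pd_mult assms)+) (simp add: algebra_simps)

text \<open>The connection half of the Leibniz rule: the \<open>pd\<close> terms are carried along
  as symbols, and \<open>has_pd_kulkarni_nomizu\<close> gives them their analytic meaning.\<close>

lemma kulkarni_nomizu_cov_deriv2:
  "kulkarni_nomizu (cov_deriv2 g X x e) Z x b1 b2 b3 b4 + kulkarni_nomizu X (cov_deriv2 g Z x e) x b1 b2 b3 b4 =
     kulkarni_nomizu (\<lambda>x b c. pd e (\<lambda>y. X y b c) x) Z x b1 b2 b3 b4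
     + kulkarni_nomizu X (\<lambda>x b c. pd e (\<lambda>y. Z y b c) x) x b1 b2 b3 b4
     - (\<Sum>a\<in>UNIV. christoffel g x a e b1 * kulkarni_nomizu X Z x a b2 b3 b4
       + christoffel g x a e b2 * kulkarni_nomizu X Z x b1 a b3 b4
       + christoffel g x a e b3 * kulkarni_nomizu X Z x b1 b2 a b4
       + christoffel g x a e b4 * kulkarni_nomizu X Z x b1 b2 b3 a)"
  by (simp add: kulkarni_nomizu_def cov_deriv2_def sum.distrib sum_subtractf
      sum_distrib_left sum_distrib_right algebra_simps)

lemma compatible_on_subset: "compatible_on U g H D \<Longrightarrow> M \<subseteq> U \<Longrightarrow> compatible_on M g H D"
  unfolding compatible_on_def by blast

lemma generalized_roter_onI:
  assumes "smooth_scalar_on V R11" "smooth_scalar_on V R12" "smooth_scalar_on V R22"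
    "smooth_scalar_on V R13" "smooth_scalar_on V R23" "smooth_scalar_on V R33"
    and "\<And>x e f s t. x \<in> V \<Longrightarrow> riemann g x e f s t =
          R11 x * kulkarni_nomizu g g x e f s t
        + R12 x * kulkarni_nomizu g (ricci g) x e f s t
        + R22 x * kulkarni_nomizu (ricci g) (ricci g) x e f s t
        + R13 x * kulkarni_nomizu g (ricci_pow g 2) x e f s t
        + R23 x * kulkarni_nomizu (ricci g) (ricci_pow g 2) x e f s t
        + R33 x * kulkarni_nomizu (ricci_pow g 2) (ricci_pow g 2) x e f s t"
  shows "generalized_roter_on V g"
  unfolding generalized_roter_on_def
  by (rule exI[of _ R11], rule exI[of _ R12], rule exI[of _ R22], rule exI[of _ R13],
      rule exI[of _ R23], rule exI[of _ R33]) (use assms in blast)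

section \<open>Spherically symmetric metrics with a free function of time and radius\<close>

text \<open>The partial derivatives of \<open>A\<close> are parameters, so the curvature is computed
  symbolically. Using \<open>Atr\<close> for both mixed derivatives builds in their
  equality.\<close>

locale radiating_metric =
  fixes I :: "real set" and A At Ar Atr Arr :: "real \<Rightarrow> real \<Rightarrow> real"
  assumes open_I: "open I"
    and deriv_A_t: "\<And>t r. t \<in> I \<Longrightarrow> 0 < r \<Longrightarrow> ((\<lambda>u. A u r) has_real_derivative At t r) (at t)"
    and deriv_A_r: "\<And>t r. t \<in> I \<Longrightarrow> 0 < r \<Longrightarrow> (A t has_real_derivative Ar t r) (at r)"
    and deriv_Ar_t: "\<And>t r. t \<in> I \<Longrightarrow> 0 < r \<Longrightarrow> ((\<lambda>u. Ar u r) has_real_derivative Atr t r) (at t)"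
    and deriv_At_r: "\<And>t r. t \<in> I \<Longrightarrow> 0 < r \<Longrightarrow> (At t has_real_derivative Atr t r) (at r)"
    and deriv_Ar_r: "\<And>t r. t \<in> I \<Longrightarrow> 0 < r \<Longrightarrow> (Ar t has_real_derivative Arr t r) (at r)"
begin

section \<open>The chart, the metric and its inverse\<close>

definition U :: "(real^4) set" where
  "U = {x. x $ 1 \<in> I \<and> 0 < x $ 2 \<and> 0 < x $ 3 \<and> x $ 3 < pi}"

definition h :: "4 tensor2" where
  "h x i j = (if i = 1 \<and> j = 1 then A (x $ 1) (x $ 2)
     else if i = 1 \<and> j = 2 \<or> i = 2 \<and> j = 1 then -1 else 0)"

definition k :: "4 tensor2" where
  "k x i j = (if i = 3 \<and> j = 3 then - (x $ 2)\<^sup>2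
     else if i = 4 \<and> j = 4 then - ((x $ 2)\<^sup>2 * (sin (x $ 3))\<^sup>2) else 0)"

definition n :: "4 tensor2" where
  "n x i j = (if i = 1 \<and> j = 1 then 1 else 0)"

definition g :: "4 tensor2" where
  "g x i j = h x i j + k x i j"

definition g_inv :: "4 tensor2" where
  "g_inv x i j = (if i = 2 \<and> j = 2 then - A (x $ 1) (x $ 2)
     else if i = 1 \<and> j = 2 \<or> i = 2 \<and> j = 1 then -1
     else if i = 3 \<and> j = 3 then - (1 / (x $ 2)\<^sup>2)
     else if i = 4 \<and> j = 4 then - (1 / ((x $ 2)\<^sup>2 * (sin (x $ 3))\<^sup>2)) else 0)"

lemma open_U: "open U"
proof -
  have "U = (\<lambda>x. x $ 1) -` I \<inter> (\<lambda>x. x $ 2) -` {0<..} \<inter> (\<lambda>x. x $ 3) -` {0<..<pi}"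
    by (auto simp: U_def)
  then show ?thesis
    by (auto intro!: open_Int open_vimage_vec_nth open_I)
qed

lemma U_D:
  assumes "x \<in> U"
  shows "x $ 1 \<in> I" "0 < x $ 2" "sin (x $ 3) \<noteq> 0"
  using assms sin_gt_zero[of "x $ 3"] by (auto simp: U_def)

lemma ginv_g: "x \<in> U \<Longrightarrow> ginv g x i j = g_inv x i j"
proof -
  assume x: "x \<in> U"
  have "(\<chi> i j. g x i j) ** (\<chi> i j. g_inv x i j) = mat 1"
    using U_D[OF x]
    by (simp add: vec_eq_iff matrix_matrix_mult_def mat_def forall_4 sum_4 g_def h_def k_def g_inv_def)
  then have "matrix_inv (\<chi> i j. g x i j) = (\<chi> i j. g_inv x i j)"
    by (rule matrix_inv_eqI)
  then show ?thesis
    by (simp add: ginv_def)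
qed

section \<open>Christoffel symbols and their derivatives\<close>

definition chris :: "real^4 \<Rightarrow> 4 \<Rightarrow> 4 \<Rightarrow> 4 \<Rightarrow> real" where
  "chris x a b c =
    (if a = 1 then
       (if b = 1 \<and> c = 1 then Ar (x $ 1) (x $ 2) / 2
        else if b = 3 \<and> c = 3 then - (x $ 2)
        else if b = 4 \<and> c = 4 then - (x $ 2 * (sin (x $ 3))\<^sup>2) else 0)
     else if a = 2 then
       (if b = 1 \<and> c = 1 then (A (x $ 1) (x $ 2) * Ar (x $ 1) (x $ 2) - At (x $ 1) (x $ 2)) / 2
        else if b = 1 \<and> c = 2 \<or> b = 2 \<and> c = 1 then - (Ar (x $ 1) (x $ 2) / 2)
        else if b = 3 \<and> c = 3 then - (x $ 2 * A (x $ 1) (x $ 2))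
        else if b = 4 \<and> c = 4 then - (x $ 2 * A (x $ 1) (x $ 2) * (sin (x $ 3))\<^sup>2) else 0)
     else if a = 3 then
       (if b = 2 \<and> c = 3 \<or> b = 3 \<and> c = 2 then 1 / x $ 2
        else if b = 4 \<and> c = 4 then - (sin (x $ 3) * cos (x $ 3)) else 0)
     else
       (if b = 2 \<and> c = 4 \<or> b = 4 \<and> c = 2 then 1 / x $ 2
        else if b = 3 \<and> c = 4 \<or> b = 4 \<and> c = 3 then cos (x $ 3) / sin (x $ 3) else 0))"

text \<open>The case \<open>s = 1\<close>, \<open>a = 2\<close>, \<open>b = c = 1\<close> is a dummy value: the true derivative involves
  the second \<open>t\<close>-derivative of \<open>A\<close>, which cancels in the Riemann tensor.\<close>

definition d_chris :: "real^4 \<Rightarrow> 4 \<Rightarrow> 4 \<Rightarrow> 4 \<Rightarrow> 4 \<Rightarrow> real" where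
  "d_chris x s a b c =
    (if a = 1 then
       (if b = 1 \<and> c = 1 then (if s = 1 then Atr (x $ 1) (x $ 2) / 2 else if s
           = 2 then Arr (x $ 1) (x $ 2) / 2 else 0)
        else if b = 3 \<and> c = 3 then (if s = 2 then -1 else 0)
        else if b = 4 \<and> c = 4 then
          (if s = 2 then - (sin (x $ 3))\<^sup>2 else if s = 3 then - (2 * x $ 2 * sin (x $ 3) * cos (x $ 3)) else 0)
        else 0)
     else if a = 2 then
       (if b = 1 \<and> c = 1 then (if s = 2 then (A (x $ 1) (x $ 2) * Arr (x $ 1) (x $ 2)
           + (Ar (x $ 1) (x $ 2))\<^sup>2 - Atr (x $ 1) (x $ 2)) / 2 else 0)
        else if b = 1 \<and> c = 2 \<or> b = 2 \<and> c = 1 then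
          (if s = 1 then - (Atr (x $ 1) (x $ 2) / 2) else if s = 2 then - (Arr (x $ 1) (x $ 2) / 2) else 0)
        else if b = 3 \<and> c = 3 then
          (if s = 1 then - (x $ 2 * At (x $ 1) (x $ 2)) else if s = 2 then - A (x $ 1) (x $ 2)
              - x $ 2 * Ar (x $ 1) (x $ 2) else 0)
        else if b = 4 \<and> c = 4 then
          (if s = 1 then - (x $ 2 * At (x $ 1) (x $ 2) * (sin (x $ 3))\<^sup>2)
           else if s = 2 then - ((A (x $ 1) (x $ 2) + x $ 2 * Ar (x $ 1) (x $ 2)) * (sin (x $ 3))\<^sup>2)
           else if s = 3 then - (2 * x $ 2 * A (x $ 1) (x $ 2) * sin (x $ 3) * cos (x $ 3)) else 0)
        else 0)
     else if a = 3 then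
       (if b = 2 \<and> c = 3 \<or> b = 3 \<and> c = 2 then (if s = 2 then - (1 / (x $ 2)\<^sup>2) else 0)
        else if b = 4 \<and> c = 4 then (if s = 3 then (sin (x $ 3))\<^sup>2 - (cos (x $ 3))\<^sup>2 else 0)
        else 0)
     else
       (if b = 2 \<and> c = 4 \<or> b = 4 \<and> c = 2 then (if s = 2 then - (1 / (x $ 2)\<^sup>2) else 0)
        else if b = 3 \<and> c = 4 \<or> b = 4 \<and> c = 3 then
          (if s = 3 then - 1 - (cos (x $ 3) / sin (x $ 3))\<^sup>2 else 0)
        else 0))"

definition d_g :: "real^4 \<Rightarrow> 4 \<Rightarrow> 4 \<Rightarrow> 4 \<Rightarrow> real" where
  "d_g x s i j = (if i = 1 \<and> j = 1 then
        (if s = 1 then At (x $ 1) (x $ 2) else if s = 2 then Ar (x $ 1) (x $ 2) else 0)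
     else if i = 3 \<and> j = 3 then (if s = 2 then - 2 * x $ 2 else 0)
     else if i = 4 \<and> j = 4 then (if s = 2 then - 2 * x $ 2 * (sin (x $ 3))\<^sup>2 else
        if s = 3 then - 2 * (x $ 2)\<^sup>2 * sin (x $ 3) * cos (x $ 3) else 0) else 0)"

lemma has_pd_A:
  assumes "x \<in> U"
  shows "has_pd i (\<lambda>y. A (y $ 1) (y $ 2)) x
    (if i = 1 then At (x $ 1) (x $ 2) else if i = 2 then Ar (x $ 1) (x $ 2) else 0)"
  by (intro has_pd_comp2 deriv_A_t deriv_A_r U_D[OF assms])

lemma has_pd_Ar:
  assumes "x \<in> U"
  shows "has_pd i (\<lambda>y. Ar (y $ 1) (y $ 2)) x
    (if i = 1 then Atr (x $ 1) (x $ 2) else if i = 2 then Arr (x $ 1) (x $ 2) else 0)"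
  by (intro has_pd_comp2 deriv_Ar_t deriv_Ar_r U_D[OF assms])

text \<open>The direction t is excluded because the locale provides no second t-derivative of
  \<open>A\<close>.\<close>

lemma has_pd_At:
  assumes "x \<in> U" "i \<noteq> 1"
  shows "has_pd i (\<lambda>y. At (y $ 1) (y $ 2)) x (if i = 2 then Atr (x $ 1) (x $ 2) else 0)"
proof -
  have "has_pd i (\<lambda>y. At (x $ 1) (y $ 2)) x (if i = 2 then Atr (x $ 1) (x $ 2) else 0)"
    using has_pd_comp[OF deriv_At_r[OF U_D(1,2)[OF assms(1)]], of i] by (simp add: eq_commute)
  then show ?thesis using assms(2) by (simp add: has_pd_def axis_def)
qed

lemma has_pd_g:
  assumes "x \<in> U"
  shows "has_pd s (\<lambda>y. g y i j) x (d_g x s i j)"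
proof -
  have "\<forall>s i j. has_pd s (\<lambda>y. g y i j) x (d_g x s i j)"
    using U_D[OF assms] has_pd_A[OF assms]
    by (simp add: g_def h_def k_def d_g_def forall_4 has_pd_const)
      (auto simp: has_pd_def axis_def intro!: derivative_eq_intros)
  then show ?thesis by blast
qed

lemma christoffel_g:
  assumes "x \<in> U"
  shows "christoffel g x a b c = chris x a b c"
proof -
  have "\<forall>a b c. christoffel g x a b c = chris x a b c"
    using U_D[OF assms]
    by (simp add: christoffel_def ginv_g[OF assms] has_pd_imp_pd[OF has_pd_g[OF assms]] forall_4 sum_4
        g_inv_def d_g_def chris_def power2_eq_square field_simps)
  then show ?thesis by blast
qed

text \<open>The excluded pattern s = b = c contains the dummy entry of \<open>d_chris\<close>. The
  Riemann tensor with s different from t differentiates only symbols with a lower index different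
  from the direction, so it stays within this range.\<close>

lemma has_pd_chris:
  assumes "x \<in> U" "s \<noteq> b \<or> s \<noteq> c"
  shows "has_pd s (\<lambda>y. chris y a b c) x (d_chris x s a b c)"
proof -
  note I = has_pd_intros has_pd_A[OF assms(1)] has_pd_Ar[OF assms(1)] has_pd_At[OF assms(1)]
  note [simp] = U_D[OF assms(1)]
  have [simp]: "x $ 2 \<noteq> 0" using U_D(2)[OF assms(1)] by linarith
  \<comment> \<open>This and the following facts have exactly the shapes of the entries of
    \<open>chris\<close> and \<open>d_chris\<close>, so that the final case distinction over indices
    is pure matching.\<close>
  have Ar1 [simp]: "has_pd s (\<lambda>y. Ar (y $ 1) (y $ 2) / 2) x
      (if s = 1 then Atr (x $ 1) (x $ 2) / 2 else if s = 2 then Arr (x $ 1) (x $ 2) / 2 else 0)" for s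
    by (rule has_pd_eq, (rule I | (simp add: algebra_simps; fail))+)
  have [simp]: "has_pd s (\<lambda>y. Ar (y $ 1) (y $ 2) / 2) x
      (if s = 2 then Arr (x $ 1) (x $ 2) / 2 else 0)" if "s \<noteq> 1" for s
    using Ar1[of s] that by simp
  have [simp]: "has_pd s (\<lambda>y. - (y $ 2 * (sin (y $ 3))\<^sup>2)) x
      (if s = 2 then - (sin (x $ 3))\<^sup>2 else if s = 3 then - (2 * x $ 2 * sin (x $ 3) * cos (x $ 3))
          else 0)" for s :: 4
    by (rule has_pd_eq, (rule I | (simp add: algebra_simps; fail))+)
  have [simp]: "has_pd s (\<lambda>y. (A (y $ 1) (y $ 2) * Ar (y $ 1) (y $ 2) - At (y $ 1) (y $ 2)) / 2) x
      (if s = 2 then (A (x $ 1) (x $ 2) * Arr (x $ 1) (x $ 2) + (Ar (x $ 1) (x $ 2))\<^sup>2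
          - Atr (x $ 1) (x $ 2)) / 2 else 0)"
    if "s \<noteq> 1" for s
    by (rule has_pd_eq, (rule I | (use that in simp; fail))+) (use that in \<open>auto
        simp: power2_eq_square field_simps\<close>)
  have [simp]: "has_pd s (\<lambda>y. - (y $ 2 * A (y $ 1) (y $ 2))) x
      (if s = 1 then - (x $ 2 * At (x $ 1) (x $ 2))
        else if s = 2 then - A (x $ 1) (x $ 2) - x $ 2 * Ar (x $ 1) (x $ 2) else 0)" for s
    by (rule has_pd_eq, (rule I | (simp add: algebra_simps; fail))+)
  have [simp]: "has_pd s (\<lambda>y. - (y $ 2 * A (y $ 1) (y $ 2) * (sin (y $ 3))\<^sup>2)) x
      (if s = 1 then - (x $ 2 * At (x $ 1) (x $ 2) * (sin (x $ 3))\<^sup>2)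
        else if s = 2 then - ((A (x $ 1) (x $ 2) + x $ 2 * Ar (x $ 1) (x $ 2)) * (sin (x $ 3))\<^sup>2)
        else if s = 3 then - (2 * x $ 2 * A (x $ 1) (x $ 2) * sin (x $ 3) * cos (x $ 3)) else 0)" for s
    by (rule has_pd_eq, (rule I | (simp add: algebra_simps; fail))+)
  have [simp]: "has_pd s (\<lambda>y. 1 / y $ 2) x (if s = 2 then - (1 / (x $ 2)\<^sup>2) else 0)" for s :: 4
    by (rule has_pd_eq, (rule I | simp; fail)+) (auto simp: power2_eq_square)
  have [simp]: "has_pd s (\<lambda>y. - (sin (y $ 3) * cos (y $ 3))) x
      (if s = 3 then (sin (x $ 3))\<^sup>2 - (cos (x $ 3))\<^sup>2 else 0)" for s :: 4
    by (rule has_pd_eq, (rule I | simp; fail)+) (auto simp: power2_eq_square)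
  have [simp]: "has_pd s (\<lambda>y. cos (y $ 3) / sin (y $ 3)) x
      (if s = 3 then - 1 - (cos (x $ 3) / sin (x $ 3))\<^sup>2 else 0)" for s :: 4
    by (rule has_pd_eq, (rule I | simp; fail)+) (auto simp: power2_eq_square field_simps)
  have [simp]: "has_pd s (\<lambda>y. - (y $ 2)) x (if s = 2 then - 1 else 0)" for s :: 4
    by (rule has_pd_eq, (rule I | (simp add: algebra_simps; fail))+)
  have [simp]: "has_pd s (\<lambda>y. - (Ar (y $ 1) (y $ 2) / 2)) x
      (if s = 1 then - (Atr (x $ 1) (x $ 2) / 2) else if s = 2 then - (Arr (x $ 1) (x $ 2) / 2) else 0)" for s
    by (rule has_pd_eq, (rule I | (simp add: algebra_simps; fail))+)
  have "\<forall>a b c. s \<noteq> b \<or> s \<noteq> c \<longrightarrow> has_pd s (\<lambda>y. chris y a b c) x (d_chris x s a b c)"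
    by (simp add: chris_def d_chris_def forall_4 has_pd_const split del: if_split)
  then show ?thesis using assms(2) by blast
qed

section \<open>The Riemann tensor\<close>

definition riem_hh :: "real^4 \<Rightarrow> real" where
  "riem_hh x = - Arr (x $ 1) (x $ 2) / 4"

text \<open>Here 1 is the curvature of the unit sphere and -A is the squared length of dr. The
  factor 2 below, like the 4 in \<open>riem_hh\<close>, allows for X \<and> X containing each
  product twice.\<close>

definition riem_kk :: "real^4 \<Rightarrow> real" where
  "riem_kk x = (1 - A (x $ 1) (x $ 2)) / (2 * (x $ 2)\<^sup>2)"

text \<open>On the (t,r)-surfaces the Hessian of r is -(Ar/2) h + (At/2) n. Divided by r it supplies
  this coefficient and \<open>riem_nk\<close>: the mixed curvature of a warped product is (Hess r /
  r) \<and> k.\<close>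

definition riem_hk :: "real^4 \<Rightarrow> real" where
  "riem_hk x = - Ar (x $ 1) (x $ 2) / (2 * x $ 2)"

definition riem_nk :: "real^4 \<Rightarrow> real" where
  "riem_nk x = At (x $ 1) (x $ 2) / (2 * x $ 2)"

text \<open>For s different from t only derivatives covered by \<open>has_pd_chris\<close> occur;
  the case s = t is later settled by antisymmetry.\<close>

lemma riemann_chris:
  assumes "x \<in> U" "s \<noteq> t"
  shows "riemann g x e f s t = (\<Sum>a\<in>UNIV. g x e a *
     (d_chris x s a f t - d_chris x t a f s
      + (\<Sum>b\<in>UNIV. chris x b f t * chris x a b s - chris x b f s * chris x a b t)))"
proof -
  have "pd s (\<lambda>y. christoffel g y a b c) x = d_chris x s a b c" if "s \<noteq> c" for s a b c
  proof -
    have "pd s (\<lambda>y. christoffel g y a b c) x = pd s (\<lambda>y. chris y a b c) x"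
      by (rule pd_cong[OF open_U assms(1)]) (rule christoffel_g)
    then show ?thesis
      using has_pd_imp_pd[OF has_pd_chris[OF assms(1)]] that by simp
  qed
  then show ?thesis
    using assms by (simp add: riemann_def christoffel_g)
qed

lemma riemann_g:
  assumes "x \<in> U"
  shows "riemann g x e f s t = riem_hh x * kulkarni_nomizu h h x e f s t
    + riem_kk x * kulkarni_nomizu k k x e f s t + riem_hk x * kulkarni_nomizu h k x e f s t
    + riem_nk x * kulkarni_nomizu n k x e f s t" (is "_ = ?R e f s t")
proof -
  \<comment> \<open>Eliminating squared cosines leaves normal forms that can be compared as
    polynomials in the sine.\<close>
  have sc: "cos (x $ 3) * cos (x $ 3) = 1 - sin (x $ 3) * sin (x $ 3)"
    using sin_cos_squared_add[of "x $ 3"] by (simp add: power2_eq_square)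
  \<comment> \<open>Both sides are antisymmetric in s and t, so the component computation is needed
    for six pairs only.\<close>
  have *: "riemann g x e f s t = ?R e f s t" if "(s, t) \<in> {(1, 2), (1, 3), (1, 4), (2, 3), (2, 4), (3, 4)}"
    for e f s t
    using exhaust_4[of e] exhaust_4[of f] that U_D[OF assms]
    apply (elim disjE insertE emptyE)
    apply (simp_all add: riemann_chris[OF assms] sum_4 g_def h_def k_def)
    apply (simp_all add: chris_def d_chris_def)
    apply (simp_all add: kulkarni_nomizu_def h_def k_def n_def riem_hh_def riem_kk_def riem_hk_def riem_nk_def)
    apply (simp_all add: power2_eq_square field_simps sc)
    apply (simp_all add: power4_eq_xxxx algebra_simps)
    done
  have r: "riemann g x e f s t = - riemann g x e f t s"
    unfolding riemann_def sum_negf[symmetric]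
    by (intro sum.cong refl) (simp add: sum_subtractf algebra_simps)
  have R: "?R e f s t = - ?R e f t s"
    by (simp add: kulkarni_nomizu_def algebra_simps)
  consider "s = t" | "(s, t) \<in> {(1, 2), (1, 3), (1, 4), (2, 3), (2, 4), (3, 4)}"
    | "(t, s) \<in> {(1, 2), (1, 3), (1, 4), (2, 3), (2, 4), (3, 4)}"
    using exhaust_4[of s] exhaust_4[of t] by auto
  then show ?thesis
  proof cases
    case 1
    then show ?thesis by (simp add: riemann_def kulkarni_nomizu_def)
  next
    case 2
    then show ?thesis by (rule *)
  next
    case 3
    then show ?thesis using r R *[OF 3, of e f] by linarith
  qed
qed

section \<open>Contractions: Ricci, scalar, Weyl and conharmonic curvature\<close>

lemma h_sym: "h x i j = h x j i" by (auto simp: h_def)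
lemma k_sym: "k x i j = k x j i" by (auto simp: k_def)
lemma n_sym: "n x i j = n x j i" by (auto simp: n_def)
lemma ginv_sym: "x \<in> U \<Longrightarrow> ginv g x i j = ginv g x j i" by (auto simp: ginv_g g_inv_def)

lemma tensor_comp_base:
  assumes "x \<in> U"
  shows "tensor_comp g h h x i j = h x i j" "tensor_comp g h k x i j = 0" "tensor_comp g h n x i j = n x i j"
    "tensor_comp g k h x i j = 0" "tensor_comp g k k x i j = k x i j" "tensor_comp g k n x i j = 0"
    "tensor_comp g n h x i j = n x i j" "tensor_comp g n k x i j = 0" "tensor_comp g n n x i j = 0"
  using exhaust_4[of i] exhaust_4[of j] U_D[OF assms]
  by (auto simp: tensor_comp_def ginv_g[OF assms] sum_4 g_inv_def h_def k_def n_def power2_eq_square)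

text \<open>On a surface n \<and> h is half the trace of n times h \<and> h, and n is trace-free
  because dt is null.\<close>

lemma kulkarni_nomizu_n_h: "kulkarni_nomizu n h x e f s t = 0"
  by (simp add: kulkarni_nomizu_def n_def h_def)

lemma kulkarni_nomizu_n_n: "kulkarni_nomizu n n x e f s t = 0"
  by (simp add: kulkarni_nomizu_def n_def)

lemma trace_base:
  assumes "x \<in> U"
  shows "(\<Sum>i\<in>UNIV. \<Sum>j\<in>UNIV. ginv g x i j * h x i j) = 2"
    "(\<Sum>i\<in>UNIV. \<Sum>j\<in>UNIV. ginv g x i j * k x i j) = 2"
    "(\<Sum>i\<in>UNIV. \<Sum>j\<in>UNIV. ginv g x i j * n x i j) = 0"
  using U_D[OF assms] by (auto simp: ginv_g[OF assms] sum_4 g_inv_def h_def k_def n_def power2_eq_square)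

text \<open>Contraction sends \<open>hh\<close> to 2h, \<open>kk\<close> to 2k, \<open>hk\<close> to
  2h + 2k and \<open>nk\<close> to 2n; the three Ricci coefficients collect these.\<close>

definition ric_h :: "real^4 \<Rightarrow> real" where
  "ric_h x = 2 * riem_hh x + 2 * riem_hk x"

definition ric_k :: "real^4 \<Rightarrow> real" where
  "ric_k x = 2 * riem_kk x + 2 * riem_hk x"

definition ric_n :: "real^4 \<Rightarrow> real" where
  "ric_n x = 2 * riem_nk x"

lemma ricci_g:
  assumes "x \<in> U"
  shows "ricci g x i j = ric_h x * h x i j + ric_k x * k x i j + ric_n x * n x i j"
proof -
  \<comment> \<open>Contracting the outer slots of X \<and> Z turns two of its four terms into
    traces and the other two into composites.\<close>
  have *: "(\<Sum>e\<in>UNIV. \<Sum>t\<in>UNIV. ginv g x e t * kulkarni_nomizu X Z x e i j t) =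
     (\<Sum>e\<in>UNIV. \<Sum>t\<in>UNIV. ginv g x e t * X x e t) * Z x i j
     + X x i j * (\<Sum>e\<in>UNIV. \<Sum>t\<in>UNIV. ginv g x e t * Z x e t)
     - tensor_comp g X Z x j i - tensor_comp g X Z x i j"
    if "\<And>i j. X x i j = X x j i" "\<And>i j. Z x i j = Z x j i" for X Z :: "4 tensor2"
  proof -
    have "(\<Sum>e\<in>UNIV. \<Sum>t\<in>UNIV. ginv g x e t * (X x e j * Z x i t)) = tensor_comp g X Z x j i"
      unfolding tensor_comp_def by (intro sum.cong refl) (simp add: that(1)[of j] that(2)[of i])
    moreover have "(\<Sum>e\<in>UNIV. \<Sum>t\<in>UNIV. ginv g x e t * (X x i t * Z x e j)) = tensor_comp g X Z x i j"
      unfolding tensor_comp_def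
      by (subst sum.swap, intro sum.cong refl) (simp add: ginv_sym[OF assms])
    ultimately
    show ?thesis
      by (simp add: kulkarni_nomizu_def sum.distrib sum_subtractf sum_distrib_left sum_distrib_right
          algebra_simps)
  qed
  have "ricci g x i j = riem_hh x * (\<Sum>e\<in>UNIV. \<Sum>t\<in>UNIV. ginv g x e t * kulkarni_nomizu h h x e i j t)
     + riem_kk x * (\<Sum>e\<in>UNIV. \<Sum>t\<in>UNIV. ginv g x e t * kulkarni_nomizu k k x e i j t)
     + riem_hk x * (\<Sum>e\<in>UNIV. \<Sum>t\<in>UNIV. ginv g x e t * kulkarni_nomizu h k x e i j t)
     + riem_nk x * (\<Sum>e\<in>UNIV. \<Sum>t\<in>UNIV. ginv g x e t * kulkarni_nomizu n k x e i j t)"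
    by (simp add: ricci_def riemann_g[OF assms] sum.distrib sum_distrib_left algebra_simps)
  then show ?thesis
    by (simp add: *[OF h_sym h_sym] *[OF k_sym k_sym] *[OF h_sym k_sym] *[OF n_sym k_sym]
        trace_base[OF assms] tensor_comp_base[OF assms] h_sym[of x j] k_sym[of x j])
      (simp add: ric_h_def ric_k_def ric_n_def algebra_simps)
qed

abbreviation "hh \<equiv> kulkarni_nomizu h h"
abbreviation "kk \<equiv> kulkarni_nomizu k k"
abbreviation "hk \<equiv> kulkarni_nomizu h k"
abbreviation "nk \<equiv> kulkarni_nomizu n k"

lemma scalar_curv_g:
  assumes "x \<in> U"
  shows "scalar_curv g x = 2 * ric_h x + 2 * ric_k x"
proof -
  have "scalar_curv g x = ric_h x * (\<Sum>i\<in>UNIV. \<Sum>j\<in>UNIV. ginv g x i j * h x i j)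
    + ric_k x * (\<Sum>i\<in>UNIV. \<Sum>j\<in>UNIV. ginv g x i j * k x i j)
    + ric_n x * (\<Sum>i\<in>UNIV. \<Sum>j\<in>UNIV. ginv g x i j * n x i j)"
    by (simp add: scalar_curv_def ricci_g[OF assms] sum.distrib sum_distrib_left algebra_simps)
  then show ?thesis
    by (simp add: trace_base[OF assms])
qed

lemma kulkarni_nomizu_g_g:
  "kulkarni_nomizu g g x e f s t = hh x e f s t + kk x e f s t + 2 * hk x e f s t"
  by (simp add: kulkarni_nomizu_def g_def algebra_simps)

lemma kulkarni_nomizu_g_ricci:
  assumes "x \<in> U"
  shows "kulkarni_nomizu g (ricci g) x e f s t =
    ric_h x * hh x e f s t + ric_k x * kk x e f s t + (ric_h x + ric_k x) * hk x e f s t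
        + ric_n x * nk x e f s t"
proof -
  have "kulkarni_nomizu g (ricci g) x e f s t =
    ric_h x * hh x e f s t + ric_k x * kk x e f s t + (ric_h x + ric_k x) * hk x e f s t
        + ric_n x * nk x e f s t
    + ric_n x * kulkarni_nomizu n h x e f s t"
    by (simp add: kulkarni_nomizu_def g_def ricci_g[OF assms] algebra_simps)
  then show ?thesis
    by (simp add: kulkarni_nomizu_n_h)
qed

text \<open>The functional hh + kk - hk on coefficients vanishes on g \<and> h and g \<and> k and
  equals 3 on the trace-free combination \<open>hh + kk - hk\<close>, which explains the division by
  3.\<close>

definition weyl_coeff :: "real^4 \<Rightarrow> real" where
  "weyl_coeff x = (riem_hh x + riem_kk x - riem_hk x) / 3"

lemma weyl_g:
  assumes "x \<in> U"
  shows "weyl g x e f s t = weyl_coeff x * (hh x e f s t + kk x e f s t - hk x e f s t)"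
  by (simp add: weyl_def riemann_g[OF assms] kulkarni_nomizu_g_g kulkarni_nomizu_g_ricci[OF assms]
      scalar_curv_g[OF assms])
    (simp add: ric_h_def ric_k_def ric_n_def weyl_coeff_def field_simps)

text \<open>The conharmonic tensor is the Weyl tensor minus a multiple of g \<and> g, so it has no
  \<open>nk\<close> part either and falls under \<open>curv_dot_no_null\<close>.\<close>

lemma conharmonic_g:
  assumes "x \<in> U"
  shows "conharmonic g x e f s t =
    (weyl_coeff x - scalar_curv g x / 12) * (hh x e f s t + kk x e f s t)
    + (- weyl_coeff x - scalar_curv g x / 6) * hk x e f s t"
proof -
  have "conharmonic g x e f s t = weyl g x e f s t - scalar_curv g x / 12 * kulkarni_nomizu g g x e f s t"
    by (simp add: weyl_def conharmonic_def)
  then show ?thesis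
    by (simp add: weyl_g[OF assms] kulkarni_nomizu_g_g algebra_simps)
qed

lemma concircular_g:
  assumes "x \<in> U"
  shows "concircular g x e f s t =
    (riem_hh x - scalar_curv g x / 24) * hh x e f s t + (riem_kk x - scalar_curv g x / 24) * kk x e f s t
    + (riem_hk x - scalar_curv g x / 12) * hk x e f s t + riem_nk x * nk x e f s t"
  by (simp add: concircular_def riemann_g[OF assms] kulkarni_nomizu_g_g algebra_simps)

section \<open>Curvature acting as a derivation\<close>

lemma curv_dot2_base:
  assumes x: "x \<in> U"
  shows "curv_dot2 g hh h x r s y b c = 0"
    "curv_dot2 g kk h x r s y b c = 0"
    "curv_dot2 g hk h x r s y b c = tachibana2 k h x r s y b c"
    "curv_dot2 g nk h x r s y b c = tachibana2 k n x r s y b c"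
    "curv_dot2 g hh k x r s y b c = 0"
    "curv_dot2 g kk k x r s y b c = 0"
    "curv_dot2 g hk k x r s y b c = - tachibana2 k h x r s y b c"
    "curv_dot2 g nk k x r s y b c = - tachibana2 k n x r s y b c"
    "curv_dot2 g hh n x r s y b c = 2 * tachibana2 h n x r s y b c"
    "curv_dot2 g kk n x r s y b c = 0"
    "curv_dot2 g hk n x r s y b c = tachibana2 k n x r s y b c"
    "curv_dot2 g nk n x r s y b c = 0"
  by (simp_all add: curv_dot2_kulkarni_nomizu[of h, OF h_sym] curv_dot2_kulkarni_nomizu[of k, OF k_sym]
      curv_dot2_kulkarni_nomizu[of n, OF n_sym] tensor_comp_base[OF x] tachibana2_def
      h_sym[of x] k_sym[of x] n_sym[of x] algebra_simps)

lemma tachibana2_swap: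
  "tachibana2 h h x r s y b c = 0" "tachibana2 k k x r s y b c = 0" "tachibana2 n n x r s y b c = 0"
  "tachibana2 h k x r s y b c = - tachibana2 k h x r s y b c"
  "tachibana2 n k x r s y b c = - tachibana2 k n x r s y b c"
  "tachibana2 n h x r s y b c = - tachibana2 h n x r s y b c"
  by (simp_all add: tachibana2_def h_sym[of x] k_sym[of x] n_sym[of x] algebra_simps)

text \<open>\<open>hh\<close> and \<open>kk\<close> annihilate h and k, while \<open>hk\<close>
  sends h to Q(k,h) = Q(g,h) and k to -Q(k,h) = Q(g,k). Hence L acts on both generators as l3 Q(g,
  _), and both sides are derivations.\<close>

lemma curv_dot_no_null:
  assumes x: "x \<in> U"
    and L: "\<And>e f s t. L x e f s t = l1 * hh x e f s t + l2 * kk x e f s t + l3 * hk x e f s t"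
    and W: "\<And>e f s t. W x e f s t = w1 * hh x e f s t + w2 * kk x e f s t + w3 * hk x e f s t"
  shows "curv_dot g L W x b1 b2 b3 b4 r s = l3 * tachibana g W x b1 b2 b3 b4 r s"
proof -
  let ?L = "\<lambda>x e f s t. l1 * hh x e f s t + l2 * kk x e f s t + l3 * hk x e f s t"
  let ?W = "\<lambda>x e f s t. w1 * hh x e f s t + w2 * kk x e f s t + w3 * hk x e f s t"
  have h: "curv_dot2 g L h x r s x i j = l3 * tachibana2 g h x r s x i j"
   and k: "curv_dot2 g L k x r s x i j = l3 * tachibana2 g k x r s x i j" for i j
    unfolding curv_dot2_cong[of L x ?L, OF L]
    by (simp_all add: curv_dot2_add curv_dot2_cmult curv_dot2_base[OF x])
      (simp_all add: tachibana2_def g_def h_sym[of x] k_sym[of x] algebra_simps)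
  have "curv_dot g L ?W x b1 b2 b3 b4 r s = l3 * tachibana g ?W x b1 b2 b3 b4 r s"
    by (simp add: curv_dot_add curv_dot_cmult tachibana_add tachibana_cmult
        curv_dot_kulkarni_nomizu tachibana_kulkarni_nomizu)
      (simp add: kulkarni_nomizu_def h k algebra_simps)
  then show ?thesis
    using curv_dot_cong[of L x L W ?W g, OF refl W] tachibana_cong[of g x g W ?W, OF refl W]
    by simp
qed

text \<open>Both R . R and Q(S,R) expand in Q(k,h), Q(k,n), Q(h,n), multiplied by h, k or n. In the
  difference the part without n is a multiple of Q(k,h) \<and> (h - k), as is Q(g,C); comparing the
  two gives the quotient with 3 \<open>weyl_coeff\<close>.\<close>

lemma curv_dot_riemann:
  assumes x: "x \<in> U" and w: "weyl_coeff x \<noteq> 0"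
  shows "curv_dot g (riemann g) (riemann g) x b1 b2 b3 b4 r s
       + (4 * riem_hh x * riem_kk x - (riem_hk x)\<^sup>2) / (3 * weyl_coeff x) * tachibana g (weyl g) x b1 b2
           b3 b4 r s
    = tachibana (ricci g) (riemann g) x b1 b2 b3 b4 r s"
proof -
  let ?R = "\<lambda>x e f s t. riem_hh x * hh x e f s t + riem_kk x * kk x e f s t + riem_hk x * hk x e f s t
      + riem_nk x * nk x e f s t"
  let ?W = "\<lambda>x e f s t. weyl_coeff x * hh x e f s t + weyl_coeff x * kk x e f s t
      + (- weyl_coeff x) * hk x e f s t"
  define p where "p = (\<lambda>i j. tachibana2 k h x r s x i j)"
  define q where "q = (\<lambda>i j. tachibana2 k n x r s x i j)"
  define z where "z = (\<lambda>i j. tachibana2 h n x r s x i j)"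
  have RR: "curv_dot g (riemann g) (riemann g) x b1 b2 b3 b4 r s = curv_dot g (riemann g) ?R x b1 b2 b3 b4 r s"
    by (rule curv_dot_cong) (simp_all add: riemann_g[OF x])
  have W: "tachibana g (weyl g) x b1 b2 b3 b4 r s = tachibana g ?W x b1 b2 b3 b4 r s"
    by (rule tachibana_cong) (simp_all add: weyl_g[OF x] algebra_simps)
  have SR: "tachibana (ricci g) (riemann g) x b1 b2 b3 b4 r s = tachibana (ricci g) ?R x b1 b2 b3 b4 r s"
    by (rule tachibana_cong) (simp_all add: riemann_g[OF x])
  have D: "curv_dot2 g (riemann g) h x r s x i j = riem_hk x * p i j + riem_nk x * q i j"
    "curv_dot2 g (riemann g) k x r s x i j = - riem_hk x * p i j - riem_nk x * q i j"
    "curv_dot2 g (riemann g) n x r s x i j = 2 * riem_hh x * z i j + riem_hk x * q i j" for i j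
    unfolding curv_dot2_cong[of "riemann g" x ?R, OF riemann_g[OF x]]
    by (simp_all add: curv_dot2_add curv_dot2_cmult curv_dot2_base[OF x] p_def q_def z_def)
  have lin: "tachibana2 (ricci g) X x r s x i j = ric_h x * tachibana2 h X x r s x i j
     + ric_k x * tachibana2 k X x r s x i j + ric_n x * tachibana2 n X x r s x i j" for X i j
    by (simp add: tachibana2_def ricci_g[OF x] algebra_simps)
  have T: "tachibana2 (ricci g) h x r s x i j = ric_k x * p i j - ric_n x * z i j"
    "tachibana2 (ricci g) k x r s x i j = - ric_h x * p i j - ric_n x * q i j"
    "tachibana2 (ricci g) n x r s x i j = ric_h x * z i j + ric_k x * q i j" for i j
    by (simp_all add: lin tachibana2_swap p_def q_def z_def)
  have G: "tachibana2 g h x r s x i j = p i j" "tachibana2 g k x r s x i j = - p i j" for i j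
    by (simp_all add: p_def tachibana2_def g_def h_sym[of x] k_sym[of x] algebra_simps)
  define N where "N X = (\<lambda>Y. X b1 b4 * Y b2 b3 + X b2 b3 * Y b1 b4 - X b1 b3 * Y b2 b4 - X b2 b4 * Y b1 b3)"
    for X Y :: "4 \<Rightarrow> 4 \<Rightarrow> real"
  have N: "kulkarni_nomizu X Y x b1 b2 b3 b4 = N (X x) (Y x)" for X Y
    by (simp add: kulkarni_nomizu_def N_def)
  \<comment> \<open>The terms that remain are \<open>Q(k, n \<and> h)\<close>, \<open>Q(h, n \<and> h)\<close> and \<open>Q(k, n \<and> n)\<close>, all zero.\<close>
  have null: "N q (h x) + N (n x) p = 0" "N z (h x) = 0" "N q (n x) = 0"
  proof -
    show "N q (h x) + N (n x) p = 0"
      using tachibana_kulkarni_nomizu[of k n h x b1 b2 b3 b4 r s]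
      by (simp add: tachibana_def kulkarni_nomizu_n_h N p_def q_def tachibana2_def)
    show "N z (h x) = 0"
      using tachibana_kulkarni_nomizu[of h n h x b1 b2 b3 b4 r s]
      by (simp add: tachibana_def kulkarni_nomizu_n_h N z_def)
        (simp add: N_def tachibana2_swap)
    show "N q (n x) = 0"
      using tachibana_kulkarni_nomizu[of k n n x b1 b2 b3 b4 r s]
      by (simp add: tachibana_def kulkarni_nomizu_n_n N q_def tachibana2_def)
        (simp add: N_def tachibana2_def algebra_simps)
  qed
  have "curv_dot g (riemann g) ?R x b1 b2 b3 b4 r s - tachibana (ricci g) ?R x b1 b2 b3 b4 r s
      + (4 * riem_hh x * riem_kk x - (riem_hk x)\<^sup>2) * (N p (h x) - N p (k x))
    = riem_nk x * (2 * riem_hh x + riem_hk x) * (N q (h x) + N (n x) p) + 4 * riem_hh x * riem_nk x * N z (h x)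
      + riem_nk x * riem_nk x * N q (n x)"
    by (simp add: curv_dot_add curv_dot_cmult tachibana_add tachibana_cmult
        curv_dot_kulkarni_nomizu tachibana_kulkarni_nomizu)
      (simp add: kulkarni_nomizu_def N_def D T ric_h_def ric_k_def ric_n_def algebra_simps power2_eq_square)
  moreover have "tachibana g ?W x b1 b2 b3 b4 r s = 3 * weyl_coeff x * (N p (h x) - N p (k x))"
    by (simp only: tachibana_add tachibana_cmult tachibana_kulkarni_nomizu)
      (simp add: kulkarni_nomizu_def N_def G algebra_simps)
  ultimately show ?thesis
    using w by (simp add: RR W SR null)
qed

section \<open>Powers of the Ricci tensor and compatibility\<close>

lemma tensor_comp_ricci:
  assumes x: "x \<in> U"
  shows "tensor_comp g (ricci g) h x i j = ric_h x * h x i j + ric_n x * n x i j"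
    "tensor_comp g (ricci g) k x i j = ric_k x * k x i j"
    "tensor_comp g (ricci g) n x i j = ric_h x * n x i j"
  by (simp_all add: tensor_comp_add_left[of "ricci g" x "ric_h x" h "ric_k x" k "ric_n x" n, OF
      ricci_g[OF x]] tensor_comp_base[OF x])

lemma ricci_sym: "x \<in> U \<Longrightarrow> ricci g x i j = ricci g x j i"
  by (simp add: ricci_g h_sym[of x i] k_sym[of x i] n_sym[of x i])

lemma ricci_pow_2:
  assumes x: "x \<in> U"
  shows "ricci_pow g 2 x i j = (ric_h x)\<^sup>2 * h x i j + (ric_k x)\<^sup>2 * k x i j + 2 * ric_h x * ric_n x * n x i j"
proof -
  have "ricci_pow g 2 x i j = tensor_comp g (ricci g) (ricci g) x i j"
    by (simp add: numeral_2_eq_2 sum_ricci_operator[OF ginv_sym[OF x] ricci_sym[OF x]])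
  then show ?thesis
    by (simp add: tensor_comp_add_right[of "ricci g" x "ric_h x" h "ric_k x" k "ric_n x" n, OF ricci_g[OF x]]
        tensor_comp_ricci[OF x] algebra_simps power2_eq_square)
qed

lemma ricci_pow_3:
  assumes x: "x \<in> U"
  shows "ricci_pow g 3 x i j =
    ric_h x ^ 3 * h x i j + ric_k x ^ 3 * k x i j + 3 * (ric_h x)\<^sup>2 * ric_n x * n x i j"
proof -
  have "ricci_pow g 3 x i j = tensor_comp g (ricci g) (ricci_pow g 2) x i j"
    unfolding numeral_3_eq_3 numeral_2_eq_2
    by (subst ricci_pow.simps(3)) (rule sum_ricci_operator[OF ginv_sym[OF x] ricci_sym[OF x]])
  then show ?thesis
    by (simp add: tensor_comp_add_right[of "ricci_pow g 2" x "(ric_h x)\<^sup>2" h "(ric_k x)\<^sup>2" k "2 * ric_h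
        x * ric_n x" n, OF ricci_pow_2[OF x]] tensor_comp_ricci[OF x]
        algebra_simps power2_eq_square power3_eq_cube)
qed

lemma compat_defect_base:
  assumes x: "x \<in> U"
  shows "compat_defect g (ricci g) hh x e f s t = 0" "compat_defect g (ricci g) kk x e f s t = 0"
    "compat_defect g (ricci g) hk x e f s t = 0" "compat_defect g (ricci g) nk x e f s t = 0"
proof -
  have "tensor_comp g (ricci g) h x i j = tensor_comp g (ricci g) h x j i"
    "tensor_comp g (ricci g) k x i j = tensor_comp g (ricci g) k x j i"
    "tensor_comp g (ricci g) n x i j = tensor_comp g (ricci g) n x j i" for i j
    by (simp_all add: tensor_comp_ricci[OF x] h_sym[of x i] k_sym[of x i] n_sym[of x i])
  note * = this compat_defect_kulkarni_nomizu[OF ginv_sym[OF x]]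
  show "compat_defect g (ricci g) hh x e f s t = 0" by (intro * h_sym)
  show "compat_defect g (ricci g) kk x e f s t = 0" by (intro * k_sym)
  show "compat_defect g (ricci g) hk x e f s t = 0" by (intro * h_sym k_sym)
  show "compat_defect g (ricci g) nk x e f s t = 0" by (intro * n_sym k_sym)
qed

lemma compat_defect_combination:
  assumes x: "x \<in> U"
    and D: "\<And>e f s t. D x e f s t =
      d1 * hh x e f s t + d2 * kk x e f s t + d3 * hk x e f s t + d4 * nk x e f s t"
  shows "compat_defect g (ricci g) D x e f s t = 0"
proof -
  have "compat_defect g (ricci g) D x e f s t = compat_defect g (ricci g)
    (\<lambda>x e f s t. d1 * hh x e f s t + d2 * kk x e f s t + d3 * hk x e f s t + d4 * nk x e f s t) x e f s t"
    by (rule compat_defect_cong) (rule D)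
  also have "\<dots> = 0"
    by (simp only: compat_defect_add compat_defect_cmult compat_defect_base[OF x])
  finally show ?thesis .
qed

lemma compatible_riemann: "compatible_on U g (ricci g) (riemann g)"
  unfolding compatible_on_iff
  by (intro ballI allI compat_defect_combination) (auto intro: riemann_g)

lemma compatible_weyl: "compatible_on U g (ricci g) (weyl g)"
  unfolding compatible_on_iff
proof (intro ballI allI)
  fix x e f s t assume x: "x \<in> U"
  show "compat_defect g (ricci g) (weyl g) x e f s t = 0"
    by (rule compat_defect_combination[OF x, of _ "weyl_coeff x" "weyl_coeff x" "- weyl_coeff x" 0])
       (simp add: weyl_g[OF x] algebra_simps)
qed

lemma compatible_conharmonic: "compatible_on U g (ricci g) (conharmonic g)"
  unfolding compatible_on_iff
proof (intro ballI allI)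
  fix x e f s t assume x: "x \<in> U"
  show "compat_defect g (ricci g) (conharmonic g) x e f s t = 0"
    by (rule compat_defect_combination[OF x, of _ "weyl_coeff x - scalar_curv g x / 12"
          "weyl_coeff x - scalar_curv g x / 12" "- weyl_coeff x - scalar_curv g x / 6" 0])
       (simp add: conharmonic_g[OF x] algebra_simps)
qed

lemma compatible_concircular: "compatible_on U g (ricci g) (concircular g)"
  unfolding compatible_on_iff
  by (intro ballI allI compat_defect_combination) (auto intro: concircular_g)

text \<open>The projective tensor need not have pair symmetry, so the rule for products does not
  cover it. Its correction term contracts to S_ef S_st - S_es S_ft, and the cyclic sum of that
  cancels.\<close>

lemma compatible_projective: "compatible_on U g (ricci g) (projective g)"
  unfolding compatible_on_iff
proof (intro ballI allI)
  fix x e f s t assume x: "x \<in> U"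
  let ?P = "\<lambda>x e f s t. g x e t * ricci g x f s - g x f t * ricci g x e s"
  have g_sym: "g x i j = g x j i" for i j
    by (simp add: g_def h_sym[of x i] k_sym[of x i])
  have c: "tensor_comp g (ricci g) g x i j = ricci g x i j" for i j
    by (subst tensor_comp_add_right[of g x 1 h 1 k 0 n])
      (simp_all add: g_def tensor_comp_ricci[OF x] ricci_g[OF x])
  have *: "(\<Sum>d\<in>UNIV. raise_second g (ricci g) x e d * ?P x f s t d) =
      ricci g x e f * ricci g x s t - ricci g x e s * ricci g x f t" for e f s
  proof -
    have r: "(\<Sum>d\<in>UNIV. raise_second g (ricci g) x e d * g x f d) = ricci g x e f" for e f
      using sum_raise_second[where X = g, OF ginv_sym[OF x] g_sym] c by simp
    show ?thesis
      unfolding r[symmetric] sum_distrib_right sum_subtractf[symmetric]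
      by (intro sum.cong refl) (simp add: algebra_simps)
  qed
  have "compat_defect g (ricci g) ?P x e f s t = 0"
    unfolding compat_defect_def * by (simp add: ricci_sym[OF x] algebra_simps)
  moreover have "compat_defect g (ricci g) (projective g) x e f s t =
    compat_defect g (ricci g) (riemann g) x e f s t + compat_defect g (ricci g) (\<lambda>x e f s t. (- 1/3) *
        ?P x e f s t) x e f s t"
    unfolding compat_defect_add[symmetric] by (rule compat_defect_cong) (simp add: projective_def)
  ultimately show "compat_defect g (ricci g) (projective g) x e f s t = 0"
    using compatible_riemann x unfolding compatible_on_iff compat_defect_cmult by simp
qed

section \<open>Covariant derivative of the Weyl tensor\<close>

definition dr :: "4 \<Rightarrow> real" where "dr i = (if i = 2 then 1 else 0)"

lemma has_pd_h:
  assumes "x \<in> U"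
  shows "has_pd e (\<lambda>y. h y b c) x (if b = 1 \<and> c = 1 then d_g x e 1 1 else 0)"
  using has_pd_g[OF assms, of e 1 1] by (auto simp: h_def g_def k_def has_pd_const)

lemma has_pd_k:
  assumes "x \<in> U"
  shows "has_pd e (\<lambda>y. k y b c) x (if b = 1 \<and> c = 1 then 0 else d_g x e b c)"
proof -
  have "has_pd e (\<lambda>y. g y b c - h y b c) x (d_g x e b c - (if b = 1 \<and> c = 1 then d_g x e 1 1 else 0))"
    by (intro has_pd_diff has_pd_g has_pd_h assms)
  then show ?thesis by (auto simp: g_def)
qed

lemma cov_deriv2_h:
  assumes x: "x \<in> U"
  shows "cov_deriv2 g h x e x b c = (dr b * k x e c + dr c * k x e b) / x $ 2"
proof -
  have "\<forall>e b c. cov_deriv2 g h x e x b c = (dr b * k x e c + dr c * k x e b) / x $ 2"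
    using U_D[OF x]
    by (simp add: cov_deriv2_def has_pd_imp_pd[OF has_pd_h[OF x]] christoffel_g[OF x] forall_4 sum_4)
      (simp add: chris_def d_g_def h_def k_def dr_def power2_eq_square)
  then show ?thesis by blast
qed

text \<open>The metric h + k is parallel, so this is the negative of the derivative of h; both
  measure how the radius of the spheres varies.\<close>

lemma cov_deriv2_k:
  assumes x: "x \<in> U"
  shows "cov_deriv2 g k x e x b c = - ((dr b * k x e c + dr c * k x e b) / x $ 2)"
proof -
  have "\<forall>e b c. cov_deriv2 g k x e x b c = - ((dr b * k x e c + dr c * k x e b) / x $ 2)"
    using U_D[OF x]
    by (simp add: cov_deriv2_def has_pd_imp_pd[OF has_pd_k[OF x]] christoffel_g[OF x] forall_4 sum_4)
      (simp add: chris_def d_g_def h_def k_def dr_def power2_eq_square field_simps)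
  then show ?thesis by blast
qed

text \<open>With D the derivative of h and -D that of k, \<open>hh + kk - hk\<close> differentiates
  to 2 D \<and> h - 2 D \<and> k - (D \<and> k - h \<and> D); this is the origin of the factor
  3.\<close>

lemma cov_deriv4_weyl:
  assumes x: "x \<in> U" and w: "has_pd e weyl_coeff x w'"
  shows "cov_deriv4 g (weyl g) x e b1 b2 b3 b4 =
    w' * (hh x b1 b2 b3 b4 + kk x b1 b2 b3 b4 - hk x b1 b2 b3 b4)
    + 3 * weyl_coeff x * (kulkarni_nomizu (cov_deriv2 g h x e) h x b1 b2 b3 b4
                - kulkarni_nomizu (cov_deriv2 g h x e) k x b1 b2 b3 b4)"
proof -
  have ph: "has_pd e (\<lambda>y. h y b c) x (pd e (\<lambda>y. h y b c) x)" for b c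
    using has_pd_h[OF x] has_pd_imp_pd[OF has_pd_h[OF x]] by simp
  have pk: "has_pd e (\<lambda>y. k y b c) x (pd e (\<lambda>y. k y b c) x)" for b c
    using has_pd_k[OF x] has_pd_imp_pd[OF has_pd_k[OF x]] by simp
  let ?dh = "\<lambda>x b c. pd e (\<lambda>y. h y b c) x" and ?dk = "\<lambda>x b c. pd e (\<lambda>y. k y b c) x"
  have *: "has_pd e (\<lambda>y. weyl_coeff y * (hh y b1 b2 b3 b4 + kk y b1 b2 b3 b4 - hk y b1 b2 b3 b4)) x
    (w' * (hh x b1 b2 b3 b4 + kk x b1 b2 b3 b4 - hk x b1 b2 b3 b4) + weyl_coeff x *
      ((kulkarni_nomizu ?dh h x b1 b2 b3 b4 + kulkarni_nomizu h ?dh x b1 b2 b3 b4)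
       + (kulkarni_nomizu ?dk k x b1 b2 b3 b4 + kulkarni_nomizu k ?dk x b1 b2 b3 b4)
       - (kulkarni_nomizu ?dh k x b1 b2 b3 b4 + kulkarni_nomizu h ?dk x b1 b2 b3 b4)))"
    by (intro has_pd_mult has_pd_add has_pd_diff has_pd_kulkarni_nomizu w ph pk)
  have "pd e (\<lambda>y. weyl g y b1 b2 b3 b4) x =
      pd e (\<lambda>y. weyl_coeff y * (hh y b1 b2 b3 b4 + kk y b1 b2 b3 b4 - hk y b1 b2 b3 b4)) x"
    by (rule pd_cong[OF open_U x]) (rule weyl_g)
  note pd = this[unfolded has_pd_imp_pd[OF *]]
  have "cov_deriv4 g (weyl g) x e b1 b2 b3 b4 =
    w' * (hh x b1 b2 b3 b4 + kk x b1 b2 b3 b4 - hk x b1 b2 b3 b4) + weyl_coeff x * (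
      (kulkarni_nomizu (cov_deriv2 g h x e) h x b1 b2 b3 b4
          + kulkarni_nomizu h (cov_deriv2 g h x e) x b1 b2 b3 b4)
      + (kulkarni_nomizu (cov_deriv2 g k x e) k x b1 b2 b3 b4
          + kulkarni_nomizu k (cov_deriv2 g k x e) x b1 b2 b3 b4)
      - (kulkarni_nomizu (cov_deriv2 g h x e) k x b1 b2 b3 b4
          + kulkarni_nomizu h (cov_deriv2 g k x e) x b1 b2 b3 b4))"
    unfolding kulkarni_nomizu_cov_deriv2 cov_deriv4_def pd weyl_g[OF x]
    by (simp add: sum.distrib sum_subtractf sum_distrib_left algebra_simps)
  also have "\<dots> = w' * (hh x b1 b2 b3 b4 + kk x b1 b2 b3 b4 - hk x b1 b2 b3 b4)
    + 3 * weyl_coeff x * (kulkarni_nomizu (cov_deriv2 g h x e) h x b1 b2 b3 b4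
                - kulkarni_nomizu (cov_deriv2 g h x e) k x b1 b2 b3 b4)"
    by (simp add: kulkarni_nomizu_def cov_deriv2_k[OF x] cov_deriv2_h[OF x, symmetric] algebra_simps)
  finally show ?thesis .
qed

text \<open>The assumption says \<omega> = d log(r^3 \<open>weyl_coeff\<close>) wherever the
  coefficient is nonzero. Its term with 3/r absorbs the derivatives of h and k, leaving only dr
  antisymmetrized against h \<and> h.\<close>

lemma bianchi_weyl:
  assumes x: "x \<in> U" and w: "\<And>e. has_pd e weyl_coeff x (\<omega> e * weyl_coeff x - 3 * weyl_coeff x / x $ 2 * dr e)"
  shows "cov_deriv4 g (weyl g) x e f s t d + cov_deriv4 g (weyl g) x f s e t d
       + cov_deriv4 g (weyl g) x s e f t d
   = \<omega> e * weyl g x f s t d + \<omega> f * weyl g x s e t d + \<omega> s * weyl g x e f t d"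
proof -
  define c where "c = 1 / x $ 2"
  \<comment> \<open>An antisymmetrization over three indices of the two-dimensional base.\<close>
  have *: "dr e * (h x f d * h x s t - h x f t * h x s d) + dr f * (h x s d * h x e t - h x s t * h x e d)
     + dr s * (h x e d * h x f t - h x e t * h x f d) = 0" (is "?H = 0")
    using exhaust_4[of e] exhaust_4[of f] exhaust_4[of s]
    by (elim disjE) (simp_all add: h_def dr_def)
  have c: "cov_deriv2 g h x e x b c' = c * (dr b * k x e c' + dr c' * k x e b)"
    "3 * weyl_coeff x / x $ 2 * dr e = c * 3 * weyl_coeff x * dr e" for e b c'
    by (simp_all add: cov_deriv2_h[OF x] c_def)
  have "cov_deriv4 g (weyl g) x e f s t d + cov_deriv4 g (weyl g) x f s e t d
       + cov_deriv4 g (weyl g) x s e f t d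
       - (\<omega> e * weyl g x f s t d + \<omega> f * weyl g x s e t d + \<omega> s * weyl g x e f t d)
     = - 6 * weyl_coeff x * c * ?H"
    unfolding cov_deriv4_weyl[OF x w] weyl_g[OF x] kulkarni_nomizu_def c
    by (simp add: algebra_simps h_sym[of x] k_sym[of x])
  then show ?thesis
    unfolding * by simp
qed

section \<open>Roter decomposition and annihilating polynomial of the Ricci tensor\<close>

lemma kulkarni_nomizu_combination:
  assumes "\<And>i j. X x i j = x1 * h x i j + x2 * k x i j + x3 * n x i j"
    and "\<And>i j. Z x i j = z1 * h x i j + z2 * k x i j + z3 * n x i j"
  shows "kulkarni_nomizu X Z x e f s t = x1 * z1 * hh x e f s t + x2 * z2 * kk x e f s t
    + (x1 * z2 + x2 * z1) * hk x e f s t + (x2 * z3 + x3 * z2) * nk x e f s t"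
proof -
  have "kulkarni_nomizu X Z x e f s t = x1 * z1 * hh x e f s t + x2 * z2 * kk x e f s t
    + (x1 * z2 + x2 * z1) * hk x e f s t + (x2 * z3 + x3 * z2) * nk x e f s t
    + (x1 * z3 + x3 * z1) * kulkarni_nomizu n h x e f s t + x3 * z3 * kulkarni_nomizu n n x e f s t"
    by (simp add: kulkarni_nomizu_def assms algebra_simps)
  then show ?thesis
    by (simp add: kulkarni_nomizu_n_h kulkarni_nomizu_n_n)
qed

text \<open>R is matched with combinations of g \<and> g, g \<and> k, S \<and> k, k \<and> k. The
  coefficient 1/2 of S \<and> k is forced by the \<open>nk\<close> part, \<open>riem_hh\<close> by
  \<open>hh\<close>, then \<open>Y\<close> by \<open>hk\<close> and \<open>Z\<close> by
  \<open>kk\<close>. Replacing k by its quadratic expression in S yields the six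
  coefficients.\<close>

lemma riemann_roter:
  fixes x
  defines "a \<equiv> ric_h x" and "v \<equiv> 1 / (ric_k x - ric_h x)\<^sup>2" and "Y \<equiv> riem_hk x - 2 * riem_hh x - ric_h x / 2"
    and "Z \<equiv> 3 * weyl_coeff x - (ric_k x - ric_h x) / 2"
  assumes x: "x \<in> U" and ne: "ric_k x \<noteq> ric_h x"
  shows "riemann g x e f s t =
      (riem_hh x + Y * v * a\<^sup>2 + Z * v\<^sup>2 * a ^ 4) * kulkarni_nomizu g g x e f s t
    + (v * a\<^sup>2 / 2 - 2 * a * Y * v - 4 * Z * v\<^sup>2 * a ^ 3) * kulkarni_nomizu g (ricci g) x e f s t
    + (4 * a\<^sup>2 * Z * v\<^sup>2 - a * v) * kulkarni_nomizu (ricci g) (ricci g) x e f s t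
    + (Y * v + 2 * a\<^sup>2 * Z * v\<^sup>2) * kulkarni_nomizu g (ricci_pow g 2) x e f s t
    + (v / 2 - 4 * a * Z * v\<^sup>2) * kulkarni_nomizu (ricci g) (ricci_pow g 2) x e f s t
    + Z * v\<^sup>2 * kulkarni_nomizu (ricci_pow g 2) (ricci_pow g 2) x e f s t"
proof -
  \<comment> \<open>On the Ricci eigenspaces, \<open>(S - ric_h)\<^sup>2\<close> is \<open>(ric_k - ric_h)\<^sup>2\<close> times the projection \<open>k\<close>.\<close>
  let ?T = "\<lambda>i j. v * (ricci_pow g 2 x i j - 2 * a * ricci g x i j + a\<^sup>2 * g x i j)"
  have "v * (ric_k x - ric_h x)\<^sup>2 = 1"
    using ne by (simp add: v_def)
  moreover have "?T i j = v * (ric_k x - ric_h x)\<^sup>2 * k x i j" for i j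
    by (simp add: ricci_pow_2[OF x] ricci_g[OF x] g_def a_def power2_eq_square algebra_simps)
  ultimately have k: "k x i j = ?T i j" for i j
    by simp
  have gh: "g x i j = 1 * h x i j + 1 * k x i j + 0 * n x i j"
    and kh: "k x i j = 0 * h x i j + 1 * k x i j + 0 * n x i j" for i j
    by (simp_all add: g_def)
  have "riemann g x e f s t = riem_hh x * kulkarni_nomizu g g x e f s t + Y * kulkarni_nomizu g k x e f s t
    + 1/2 * kulkarni_nomizu (ricci g) k x e f s t + Z * kulkarni_nomizu k k x e f s t"
    unfolding riemann_g[OF x] kulkarni_nomizu_combination[of g x _ _ _ k, OF gh kh]
      kulkarni_nomizu_combination[of g x _ _ _ g, OF gh gh]
      kulkarni_nomizu_combination[of "ricci g" x _ _ _ k, OF ricci_g[OF x] kh]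
    by (simp add: Y_def Z_def weyl_coeff_def ric_h_def ric_k_def ric_n_def field_simps)
  also have "riem_hh x * kulkarni_nomizu g g x e f s t + Y * kulkarni_nomizu g k x e f s t
    + 1/2 * kulkarni_nomizu (ricci g) k x e f s t + Z * kulkarni_nomizu k k x e f s t =
      (riem_hh x + Y * v * a\<^sup>2 + Z * v\<^sup>2 * a ^ 4) * kulkarni_nomizu g g x e f s t
    + (v * a\<^sup>2 / 2 - 2 * a * Y * v - 4 * Z * v\<^sup>2 * a ^ 3) * kulkarni_nomizu g (ricci g) x e f s t
    + (4 * a\<^sup>2 * Z * v\<^sup>2 - a * v) * kulkarni_nomizu (ricci g) (ricci g) x e f s t
    + (Y * v + 2 * a\<^sup>2 * Z * v\<^sup>2) * kulkarni_nomizu g (ricci_pow g 2) x e f s t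
    + (v / 2 - 4 * a * Z * v\<^sup>2) * kulkarni_nomizu (ricci g) (ricci_pow g 2) x e f s t
    + Z * v\<^sup>2 * kulkarni_nomizu (ricci_pow g 2) (ricci_pow g 2) x e f s t"
    unfolding kulkarni_nomizu_def k
    by (simp add: field_simps power2_eq_square power3_eq_cube power4_eq_xxxx)
  finally show ?thesis .
qed

text \<open>The polynomial is (X - ric_h)^2 (X - ric_k): the square is needed to kill the nilpotent
  part n, and the argument allows the two eigenvalues to coincide.\<close>

lemma ricci_minimal_polynomial:
  assumes x: "x \<in> U"
  shows "ricci_pow g 3 x i j - (2 * ric_h x + ric_k x) * ricci_pow g 2 x i j
    + ((ric_h x)\<^sup>2 + 2 * ric_h x * ric_k x) * ricci g x i j - (ric_h x)\<^sup>2 * ric_k x * g x i j = 0"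
  by (simp add: ricci_pow_3[OF x] ricci_pow_2[OF x] ricci_g[OF x] g_def algebra_simps
      power2_eq_square power3_eq_cube)

end

section \<open>The Vaidya-Bonner-de Sitter metric\<close>

locale vbds =
  fixes I :: "real set" and m q :: "real \<Rightarrow> real" and \<Lambda> :: real
  assumes open_times: "open I" and smooth_m: "smooth_real_on I m" and smooth_q: "smooth_real_on I q"
begin

lemma deriv_m: "t \<in> I \<Longrightarrow> (m has_real_derivative deriv m t) (at t)"
  using smooth_m by (auto simp: smooth_real_on_def DERIV_deriv_iff_real_differentiable dest: spec[of _ 0])

lemma deriv_q: "t \<in> I \<Longrightarrow> (q has_real_derivative deriv q t) (at t)"
  using smooth_q by (auto simp: smooth_real_on_def DERIV_deriv_iff_real_differentiable dest: spec[of _ 0])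

lemma metric_function_derivs:
  assumes "t \<in> I" "0 < r"
  shows "((\<lambda>u. 1 - 2 * m u / r + (q u)\<^sup>2 / r\<^sup>2 - \<Lambda> * r\<^sup>2 / 3) has_real_derivative
     2 * q t * deriv q t / r\<^sup>2 - 2 * deriv m t / r) (at t)"
   and "((\<lambda>r. 1 - 2 * m t / r + (q t)\<^sup>2 / r\<^sup>2 - \<Lambda> * r\<^sup>2 / 3) has_real_derivative
     2 * m t / r\<^sup>2 - 2 * (q t)\<^sup>2 / r ^ 3 - 2 * \<Lambda> * r / 3) (at r)"
  and "((\<lambda>t. 2 * m t / r\<^sup>2 - 2 * (q t)\<^sup>2 / r ^ 3 - 2 * \<Lambda> * r / 3) has_real_derivative
     2 * deriv m t / r\<^sup>2 - 4 * q t * deriv q t / r ^ 3) (at t)"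
  and "((\<lambda>r. 2 * q t * deriv q t / r\<^sup>2 - 2 * deriv m t / r) has_real_derivative
     2 * deriv m t / r\<^sup>2 - 4 * q t * deriv q t / r ^ 3) (at r)"
  and "((\<lambda>r. 2 * m t / r\<^sup>2 - 2 * (q t)\<^sup>2 / r ^ 3 - 2 * \<Lambda> * r / 3) has_real_derivative
     6 * (q t)\<^sup>2 / r ^ 4 - 4 * m t / r ^ 3 - 2 * \<Lambda> / 3) (at r)"
proof -
  have r: "r \<noteq> 0" using assms by simp
  show "((\<lambda>u. 1 - 2 * m u / r + (q u)\<^sup>2 / r\<^sup>2 - \<Lambda> * r\<^sup>2 / 3) has_real_derivative
     2 * q t * deriv q t / r\<^sup>2 - 2 * deriv m t / r) (at t)"
    by (rule derivative_eq_intros deriv_m[OF assms(1)] deriv_q[OF assms(1)] refl r | simp add: r)+ (simp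
        add: field_simps eval_nat_numeral r)
   show "((\<lambda>r. 1 - 2 * m t / r + (q t)\<^sup>2 / r\<^sup>2 - \<Lambda> * r\<^sup>2 / 3) has_real_derivative
     2 * m t / r\<^sup>2 - 2 * (q t)\<^sup>2 / r ^ 3 - 2 * \<Lambda> * r / 3) (at r)"
    by (rule derivative_eq_intros refl r | simp add: r)+ (simp add: field_simps eval_nat_numeral r)
  show "((\<lambda>t. 2 * m t / r\<^sup>2 - 2 * (q t)\<^sup>2 / r ^ 3 - 2 * \<Lambda> * r / 3) has_real_derivative
     2 * deriv m t / r\<^sup>2 - 4 * q t * deriv q t / r ^ 3) (at t)"
    by (rule derivative_eq_intros deriv_m[OF assms(1)] deriv_q[OF assms(1)] refl r | simp add: r)+ (simp
        add: field_simps eval_nat_numeral r)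
  show "((\<lambda>r. 2 * q t * deriv q t / r\<^sup>2 - 2 * deriv m t / r) has_real_derivative
     2 * deriv m t / r\<^sup>2 - 4 * q t * deriv q t / r ^ 3) (at r)"
    by (rule derivative_eq_intros refl r | simp add: r)+ (simp add: field_simps eval_nat_numeral r)
  show "((\<lambda>r. 2 * m t / r\<^sup>2 - 2 * (q t)\<^sup>2 / r ^ 3 - 2 * \<Lambda> * r / 3) has_real_derivative
     6 * (q t)\<^sup>2 / r ^ 4 - 4 * m t / r ^ 3 - 2 * \<Lambda> / 3) (at r)"
    by (rule derivative_eq_intros refl r | simp add: r)+ (simp add: field_simps eval_nat_numeral r)
qed
definition f_A :: "real \<Rightarrow> real \<Rightarrow> real" where
  "f_A t r = 1 - 2 * m t / r + (q t)\<^sup>2 / r\<^sup>2 - \<Lambda> * r\<^sup>2 / 3"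

definition f_At :: "real \<Rightarrow> real \<Rightarrow> real" where
  "f_At t r = 2 * q t * deriv q t / r\<^sup>2 - 2 * deriv m t / r"

definition f_Ar :: "real \<Rightarrow> real \<Rightarrow> real" where
  "f_Ar t r = 2 * m t / r\<^sup>2 - 2 * (q t)\<^sup>2 / r ^ 3 - 2 * \<Lambda> * r / 3"

definition f_Atr :: "real \<Rightarrow> real \<Rightarrow> real" where
  "f_Atr t r = 2 * deriv m t / r\<^sup>2 - 4 * q t * deriv q t / r ^ 3"

definition f_Arr :: "real \<Rightarrow> real \<Rightarrow> real" where
  "f_Arr t r = 6 * (q t)\<^sup>2 / r ^ 4 - 4 * m t / r ^ 3 - 2 * \<Lambda> / 3"

sublocale radiating_metric I f_A f_At f_Ar f_Atr f_Arr
  by unfold_locales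
    (simp_all add: f_A_def[abs_def] f_At_def[abs_def] f_Ar_def[abs_def] f_Atr_def[abs_def]
      f_Arr_def[abs_def] open_times metric_function_derivs)

lemma g_eq: "g = vbds_metric m q \<Lambda>"
  by (intro ext) (auto simp: vbds_metric_def g_def h_def k_def f_A_def)

lemma domain_subset: "vbds_domain m q I \<subseteq> U"
  by (auto simp: vbds_domain_def U_def)

lemma ne_domain: "x \<in> vbds_domain m q I \<Longrightarrow> x $ 2 * m (x $ 1) - (q (x $ 1))\<^sup>2 \<noteq> 0"
  by (auto simp: vbds_domain_def)

lemma open_domain: "open (vbds_domain m q I)" "open {x \<in> vbds_domain m q I. q (x $ 1) \<noteq> 0}"
proof -
  have "continuous_on I m" "continuous_on I q"
    using deriv_m deriv_q by (auto intro!: continuous_at_imp_continuous_on DERIV_isCont)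
  moreover have "continuous_on U (\<lambda>x. x $ 1)" "(\<lambda>x. x $ 1) ` U \<subseteq> I"
    by (auto intro!: continuous_intros simp: U_def)
  ultimately have "continuous_on U (\<lambda>x. m (x $ 1))" "continuous_on U (\<lambda>x. q (x $ 1))"
    by (auto intro: continuous_on_compose2)
  note * = this
  have "open (U \<inter> (\<lambda>x. (q (x $ 1))\<^sup>2 - x $ 2 * m (x $ 1)) -` (- {0}))"
    by (rule continuous_open_preimage[OF _ open_U]) (auto intro!: continuous_intros *)
  moreover have "vbds_domain m q I = U \<inter> (\<lambda>x. (q (x $ 1))\<^sup>2 - x $ 2 * m (x $ 1)) -` (- {0})"
    by (auto simp: vbds_domain_def U_def)
  ultimately show 1: "open (vbds_domain m q I)" by simp
  have "open (U \<inter> (\<lambda>x. q (x $ 1)) -` (- {0}))"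
    by (rule continuous_open_preimage[OF _ open_U]) (auto intro!: *)
  moreover have "{x \<in> vbds_domain m q I. q (x $ 1) \<noteq> 0}
      = vbds_domain m q I \<inter> (U \<inter> (\<lambda>x. q (x $ 1)) -` (- {0}))"
    using domain_subset by auto
  ultimately show "open {x \<in> vbds_domain m q I. q (x $ 1) \<noteq> 0}" using 1 by auto
qed

text \<open>With this scalar and \<open>weyl_term\<close>, the coefficients of h \<and> h, k \<and>
  k, h \<and> k and the Ricci eigenvalues are affine expressions in
  \<open>\<Lambda>\<close>.\<close>

definition charge_term :: "real^4 \<Rightarrow> real" where "charge_term x = (q (x $ 1))\<^sup>2 / (x $ 2) ^ 4"
definition weyl_term :: "real^4 \<Rightarrow> real" where "weyl_term x = (x $ 2 * m (x $ 1) - (q (x $ 1))\<^sup>2) / (x $ 2) ^ 4"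

lemma coefficients:
  assumes "x \<in> U"
  shows "weyl_coeff x = weyl_term x" "riem_hh x = weyl_term x + \<Lambda> / 6 - charge_term x / 2" "riem_kk x
      = weyl_term x + \<Lambda> / 6 + charge_term x / 2"
    "riem_hk x = \<Lambda> / 3 - weyl_term x" "ric_h x = \<Lambda> - charge_term x" "ric_k x = \<Lambda>
        + charge_term x" "scalar_curv g x = 4 * \<Lambda>"
proof -
  show a: "riem_hh x = weyl_term x + \<Lambda> / 6 - charge_term x / 2" and b: "riem_kk x = weyl_term x + \<Lambda> / 6
      + charge_term x / 2"
    and c: "riem_hk x = \<Lambda> / 3 - weyl_term x"
    using U_D(2)[OF assms]
    by (simp_all add: riem_hh_def riem_kk_def riem_hk_def f_A_def f_Ar_def f_Arr_def charge_term_def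
        weyl_term_def field_simps power2_eq_square power3_eq_cube power4_eq_xxxx)
  show "weyl_coeff x = weyl_term x" by (simp add: weyl_coeff_def a b c field_simps)
  show S: "ric_h x = \<Lambda> - charge_term x" "ric_k x = \<Lambda> + charge_term x"
      by (simp_all add: ric_h_def ric_k_def a b c)
  show "scalar_curv g x = 4 * \<Lambda>" by (simp add: scalar_curv_g[OF assms] S)
qed

lemma smooth_charge_term: "open V \<Longrightarrow> V \<subseteq> U \<Longrightarrow> smooth_scalar_on V charge_term"
  and smooth_weyl_term: "open V \<Longrightarrow> V \<subseteq> U \<Longrightarrow> smooth_scalar_on V weyl_term"
  unfolding charge_term_def[abs_def] weyl_term_def[abs_def]
  by (auto intro!: smooth_scalar_on_intros smooth_scalar_on_intros(9)[OF _ smooth_m]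
      smooth_scalar_on_intros(9)[OF _ smooth_q] simp: U_def)

text \<open>The gap between the Ricci eigenvalues is 2 \<open>charge_term\<close>; q nonzero keeps
  it away from zero, so k can be recovered from S.\<close>

lemma generalized_roter: "generalized_roter_on {x \<in> vbds_domain m q I. q (x $ 1) \<noteq> 0} g"
proof -
  let ?V = "{x \<in> vbds_domain m q I. q (x $ 1) \<noteq> 0}"
  have VU: "?V \<subseteq> U" using domain_subset by auto
  note s = smooth_scalar_on_intros[OF open_domain(2)] smooth_charge_term[OF open_domain(2) VU]
      smooth_weyl_term[OF open_domain(2) VU]
  have u0: "charge_term x \<noteq> 0" if "x \<in> ?V" for x
    using that VU U_D(2)[of x] by (auto simp: charge_term_def)
  \<comment> \<open>These are the quantities of \<open>riemann_roter\<close> rewritten through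
    \<open>charge_term\<close> and \<open>weyl_term\<close>, whose smoothness is known.\<close>
  define a where "a = (\<lambda>x. \<Lambda> - charge_term x)"
  define v where "v = (\<lambda>x. 1 / (2 * charge_term x)\<^sup>2)"
  define X where "X = (\<lambda>x. weyl_term x + \<Lambda> / 6 - charge_term x / 2)"
  define Y where "Y = (\<lambda>x. 3 * charge_term x / 2 - 3 * weyl_term x - \<Lambda> / 2)"
  define Z where "Z = (\<lambda>x. 3 * weyl_term x - charge_term x)"
  have sm: "smooth_scalar_on ?V a" "smooth_scalar_on ?V v" "smooth_scalar_on ?V X"
     "smooth_scalar_on ?V Y" "smooth_scalar_on ?V Z"
    unfolding a_def v_def X_def Y_def Z_def by (intro s; use u0 in simp)+
  have eq: "riemann g x e f s t =
      (X x + Y x * v x * (a x)\<^sup>2 + Z x * (v x)\<^sup>2 * a x ^ 4) * kulkarni_nomizu g g x e f s t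
    + (v x * (a x)\<^sup>2 / 2 - 2 * a x * Y x * v x - 4 * Z x * (v x)\<^sup>2 * a x ^ 3) * kulkarni_nomizu g (ricci
        g) x e f s t
    + (4 * (a x)\<^sup>2 * Z x * (v x)\<^sup>2 - a x * v x) * kulkarni_nomizu (ricci g) (ricci g) x e f s t
    + (Y x * v x + 2 * (a x)\<^sup>2 * Z x * (v x)\<^sup>2) * kulkarni_nomizu g (ricci_pow g 2) x e f s t
    + (v x / 2 - 4 * a x * Z x * (v x)\<^sup>2) * kulkarni_nomizu (ricci g) (ricci_pow g 2) x e f s t
    + Z x * (v x)\<^sup>2 * kulkarni_nomizu (ricci_pow g 2) (ricci_pow g 2) x e f s t"
    if "x \<in> ?V" for x e f s t
  proof -
    have x: "x \<in> U" using that VU by blast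
    have "ric_k x \<noteq> ric_h x" using u0[OF that] by (simp add: coefficients[OF x])
    moreover have "ric_h x = a x" "1 / (ric_k x - ric_h x)\<^sup>2 = v x" "riem_hh x = X x"
      "riem_hk x - 2 * riem_hh x - ric_h x / 2 = Y x" "3 * weyl_coeff x - (ric_k x - ric_h x) / 2 = Z x"
      by (simp_all add: coefficients[OF x] a_def v_def X_def Y_def Z_def field_simps)
    ultimately show ?thesis using riemann_roter[OF x, of e f s t] by simp
  qed
  have smooth: "smooth_scalar_on ?V (\<lambda>x. X x + Y x * v x * (a x)\<^sup>2 + Z x * (v x)\<^sup>2 * a x ^ 4)"
    "smooth_scalar_on ?V (\<lambda>x. v x * (a x)\<^sup>2 / 2 - 2 * a x * Y x * v x - 4 * Z x * (v x)\<^sup>2 * a x ^ 3)"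
    "smooth_scalar_on ?V (\<lambda>x. 4 * (a x)\<^sup>2 * Z x * (v x)\<^sup>2 - a x * v x)"
    "smooth_scalar_on ?V (\<lambda>x. Y x * v x + 2 * (a x)\<^sup>2 * Z x * (v x)\<^sup>2)"
    "smooth_scalar_on ?V (\<lambda>x. v x / 2 - 4 * a x * Z x * (v x)\<^sup>2)"
    "smooth_scalar_on ?V (\<lambda>x. Z x * (v x)\<^sup>2)"
    by (intro s sm; simp)+
  show ?thesis
    by (rule generalized_roter_onI[OF smooth eq])
qed

lemma einstein_level: "einstein_level_on 3 (vbds_domain m q I) g"
proof -
  let ?V = "vbds_domain m q I"
  note s = smooth_scalar_on_intros[OF open_domain(1)] smooth_charge_term[OF open_domain(1) domain_subset]
  define a where "a = (\<lambda>x. \<Lambda> - charge_term x)"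
  define b where "b = (\<lambda>x. \<Lambda> + charge_term x)"
  \<comment> \<open>The coefficients of (X - a)^2 (X - b); its leading coefficient 1 rules out a
    simultaneous zero.\<close>
  define c where "c i = (if i = 0 then (\<lambda>x. - ((a x)\<^sup>2 * b x)) else if i = 1 then (\<lambda>x. (a x)\<^sup>2
      + 2 * a x * b x) else
    if i = 2 then (\<lambda>x. - (2 * a x + b x)) else (\<lambda>x. 1))" for i :: nat
  have "smooth_scalar_on ?V (c i)" for i
    unfolding c_def a_def b_def by (auto intro!: s)
  moreover have "c 3 x \<noteq> 0" for x
    by (simp add: c_def)
  moreover have "(\<Sum>i\<le>3. c i x * ricci_pow g i x j l) = 0" if "x \<in> ?V" for x j l
  proof -
    have x: "x \<in> U" using that domain_subset by blast
    have "(\<Sum>i\<le>3. F i) = F 0 + F 1 + F 2 + F 3" for F :: "nat \<Rightarrow> real"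
      by (simp add: numeral_3_eq_3 numeral_2_eq_2)
    then show ?thesis
      using ricci_minimal_polynomial[OF x, of j l]
      by (simp add: c_def a_def b_def coefficients[OF x] algebra_simps)
  qed
  ultimately show ?thesis
    unfolding einstein_level_on_def by (intro exI[of _ c]) auto
qed

text \<open>Since r^3 \<open>weyl_term\<close> = m - q^2/r, the given components are those of d
  log(m - q^2/r), as \<open>bianchi_weyl\<close> demands.\<close>

lemma conformal_recurrent:
  "conformal_2forms_recurrent_on (vbds_domain m q I) g (\<lambda>x i.
       let t = x $ 1; r = x $ 2; mt = m t; qt = q t in
       if i = 1 then (r * deriv m t - deriv (\<lambda>u. (q u)\<^sup>2) t) / (r * mt - qt\<^sup>2)
       else if i = 2 then qt\<^sup>2 / (r\<^sup>2 * mt - r * qt\<^sup>2)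
       else 0)" (is "conformal_2forms_recurrent_on _ _ ?\<omega>")
  unfolding conformal_2forms_recurrent_on_def
proof (intro ballI allI, rule bianchi_weyl)
  fix x e assume V: "x \<in> vbds_domain m q I"
  then show x: "x \<in> U" using domain_subset by blast
  have q2: "deriv (\<lambda>u. (q u)\<^sup>2) (x $ 1) = 2 * q (x $ 1) * deriv q (x $ 1)"
    by (rule DERIV_imp_deriv) (auto intro!: derivative_eq_intros deriv_q U_D[OF x])
  note ne = ne_domain[OF V]
  have r: "x $ 2 \<noteq> 0" using U_D(2)[OF x] by simp
  have ne': "(x $ 2)\<^sup>2 * m (x $ 1) - x $ 2 * (q (x $ 1))\<^sup>2 \<noteq> 0"
  proof -
    have "(x $ 2)\<^sup>2 * m (x $ 1) - x $ 2 * (q (x $ 1))\<^sup>2 = x $ 2 * (x $ 2 * m (x $ 1) - (q (x $ 1))\<^sup>2)"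
      by (simp add: power2_eq_square algebra_simps)
    then show ?thesis using ne r by simp
  qed
  let ?F = "\<lambda>t r. (r * m t - (q t)\<^sup>2) / r ^ 4"
  have "((\<lambda>u. ?F u (x $ 2)) has_real_derivative
      (x $ 2 * deriv m (x $ 1) - 2 * q (x $ 1) * deriv q (x $ 1)) / (x $ 2) ^ 4) (at (x $ 1))"
    by (rule derivative_eq_intros deriv_m deriv_q U_D[OF x] refl r | simp add: r)+
      (simp add: field_simps eval_nat_numeral r)
  moreover have "((\<lambda>v. ?F (x $ 1) v) has_real_derivative
      m (x $ 1) / (x $ 2) ^ 4 - 4 * weyl_term x / x $ 2) (at (x $ 2))"
    by (rule derivative_eq_intros refl r | simp add: r)+
      (simp add: weyl_term_def field_simps eval_nat_numeral r)
  ultimately have "has_pd e (\<lambda>y. ?F (y $ 1) (y $ 2)) x (if e = 1 then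
      (x $ 2 * deriv m (x $ 1) - 2 * q (x $ 1) * deriv q (x $ 1)) / (x $ 2) ^ 4
    else if e = 2 then m (x $ 1) / (x $ 2) ^ 4 - 4 * weyl_term x / x $ 2 else 0)"
    by (rule has_pd_comp2)
  then have "has_pd e weyl_coeff x (if e = 1 then
      (x $ 2 * deriv m (x $ 1) - 2 * q (x $ 1) * deriv q (x $ 1)) / (x $ 2) ^ 4
    else if e = 2 then m (x $ 1) / (x $ 2) ^ 4 - 4 * weyl_term x / x $ 2 else 0)"
    using has_pd_cong[OF open_U x coefficients(1)] by (simp add: weyl_term_def)
  then show "has_pd e weyl_coeff x (?\<omega> x e * weyl_coeff x - 3 * weyl_coeff x / x $ 2 * dr e)"
  proof (rule has_pd_eq)
    \<comment> \<open>This turns the -4w/r of the radial derivative into -3w/r plus q^2/r^5, the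
      latter being the radial component of the 1-form times w.\<close>
    have "m (x $ 1) / (x $ 2) ^ 4 = weyl_term x / x $ 2 + (q (x $ 1))\<^sup>2 / (x $ 2) ^ 5"
      using r by (simp add: weyl_term_def field_simps eval_nat_numeral)
    moreover have "weyl_term x * ((q (x $ 1))\<^sup>2 / ((x $ 2)\<^sup>2 * m (x $ 1) - x $ 2 * (q (x $ 1))\<^sup>2))
        = (q (x $ 1))\<^sup>2 / (x $ 2) ^ 5"
    proof -
      have "weyl_term x = ((x $ 2)\<^sup>2 * m (x $ 1) - x $ 2 * (q (x $ 1))\<^sup>2) / (x $ 2) ^ 5"
        using r by (simp add: weyl_term_def field_simps eval_nat_numeral)
      then show ?thesis using ne' by simp
    qed
    moreover have "weyl_term x * ((x $ 2 * deriv m (x $ 1) - 2 * q (x $ 1) * deriv q (x $ 1))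
        / (x $ 2 * m (x $ 1) - (q (x $ 1))\<^sup>2)) =
        (x $ 2 * deriv m (x $ 1) - 2 * q (x $ 1) * deriv q (x $ 1)) / (x $ 2) ^ 4"
      using ne by (simp add: weyl_term_def)
    ultimately show "(if e = 1 then (x $ 2 * deriv m (x $ 1) - 2 * q (x $ 1) * deriv q (x $ 1)) / (x $ 2) ^ 4
        else if e = 2 then m (x $ 1) / (x $ 2) ^ 4 - 4 * weyl_term x / x $ 2 else 0)
      = ?\<omega> x e * weyl_coeff x - 3 * weyl_coeff x / x $ 2 * dr e"
      unfolding Let_def q2 coefficients(1)[OF x] dr_def
      by (simp add: mult.commute[of _ "weyl_term x"] del: times_divide_eq_right times_divide_eq_left)
        (simp add: mult_ac)
  qed
qed

section \<open>The curvature identities with their explicit factors\<close>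

lemma weyl_combination:
  "x \<in> U \<Longrightarrow> weyl g x e f s t = weyl_term x * hh x e f s t + weyl_term x * kk x e f s t
      + (- weyl_term x) * hk x e f s t"
  by (simp add: weyl_g coefficients algebra_simps)

lemma conharmonic_combination:
  "x \<in> U \<Longrightarrow> conharmonic g x e f s t = (weyl_term x - \<Lambda> / 3) * hh x e f s t + (weyl_term x - \<Lambda> / 3) * kk x e f s t
    + (- weyl_term x - 2 * \<Lambda> / 3) * hk x e f s t"
  by (simp add: conharmonic_g coefficients algebra_simps)

lemma weyl_dot:
  assumes x: "x \<in> U"
  shows "curv_dot g (weyl g) (weyl g) x a b c d i j
      = - ((x $ 2 * m (x $ 1) - (q (x $ 1))\<^sup>2) / (x $ 2) ^ 4) * tachibana g (weyl g) x a b c d i j"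
    and "curv_dot g (weyl g) (conharmonic g) x a b c d i j
      = - ((x $ 2 * m (x $ 1) - (q (x $ 1))\<^sup>2) / (x $ 2) ^ 4) * tachibana g (conharmonic g) x a b c d i j"
  unfolding weyl_term_def[symmetric]
  by (rule curv_dot_no_null[OF x], rule weyl_combination[OF x], rule weyl_combination[OF x])
    (rule curv_dot_no_null[OF x], rule weyl_combination[OF x], rule conharmonic_combination[OF x])

lemma conharmonic_dot:
  assumes x: "x \<in> U"
  shows "curv_dot g (conharmonic g) (weyl g) x a b c d i j
      = - ((2 * (x $ 2) ^ 4 * \<Lambda> + 3 * x $ 2 * m (x $ 1) - 3 * (q (x $ 1))\<^sup>2) / (3 * (x $ 2) ^ 4))
        * tachibana g (weyl g) x a b c d i j"
    and "curv_dot g (conharmonic g) (conharmonic g) x a b c d i j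
      = - ((2 * (x $ 2) ^ 4 * \<Lambda> + 3 * x $ 2 * m (x $ 1) - 3 * (q (x $ 1))\<^sup>2) / (3 * (x $ 2) ^ 4))
        * tachibana g (conharmonic g) x a b c d i j"
proof -
  have *: "- ((2 * (x $ 2) ^ 4 * \<Lambda> + 3 * x $ 2 * m (x $ 1) - 3 * (q (x $ 1))\<^sup>2) / (3 * (x $ 2) ^ 4))
    = - weyl_term x - 2 * \<Lambda> / 3"
    using U_D(2)[OF x] by (simp add: weyl_term_def field_simps)
  show "curv_dot g (conharmonic g) (weyl g) x a b c d i j
      = - ((2 * (x $ 2) ^ 4 * \<Lambda> + 3 * x $ 2 * m (x $ 1) - 3 * (q (x $ 1))\<^sup>2) / (3 * (x $ 2) ^ 4))
        * tachibana g (weyl g) x a b c d i j"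
    unfolding * by (rule curv_dot_no_null[OF x], rule conharmonic_combination[OF x], rule
        weyl_combination[OF x])
  show "curv_dot g (conharmonic g) (conharmonic g) x a b c d i j
      = - ((2 * (x $ 2) ^ 4 * \<Lambda> + 3 * x $ 2 * m (x $ 1) - 3 * (q (x $ 1))\<^sup>2) / (3 * (x $ 2) ^ 4))
        * tachibana g (conharmonic g) x a b c d i j"
    unfolding * by (rule curv_dot_no_null[OF x], rule conharmonic_combination[OF x], rule
        conharmonic_combination[OF x])
qed

text \<open>In terms of w and u the quotient is (3w^2 + 2\<Lambda>w - u^2)/(3w). Multiplying
  numerator and denominator by r^8 leaves only w r^4 = rm - q^2 and u r^4 = q^2.\<close>

lemma riemann_factor:
  assumes "x \<in> vbds_domain m q I"
  shows "(4 * riem_hh x * riem_kk x - (riem_hk x)\<^sup>2) / (3 * weyl_coeff x) =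
    (2 * (x $ 2) ^ 5 * \<Lambda> * m (x $ 1) + 3 * (x $ 2)\<^sup>2 * (m (x $ 1))\<^sup>2 - 2 * (x $ 2) ^ 4 * \<Lambda> * (q (x $ 1))\<^sup>2
      - 6 * x $ 2 * m (x $ 1) * (q (x $ 1))\<^sup>2 + 2 * q (x $ 1) ^ 4)
    / (3 * (x $ 2) ^ 4 * (x $ 2 * m (x $ 1) - (q (x $ 1))\<^sup>2))"
proof -
  have x: "x \<in> U" using assms domain_subset by blast
  have r: "x $ 2 \<noteq> 0" using U_D(2)[OF x] by simp
  have w: "weyl_term x * (x $ 2) ^ 4 = x $ 2 * m (x $ 1) - (q (x $ 1))\<^sup>2" and u: "charge_term x * (x $
      2) ^ 4 = (q (x $ 1))\<^sup>2"
    using r by (simp_all add: weyl_term_def charge_term_def)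
  have w0: "weyl_term x \<noteq> 0" using w ne_domain[OF assms] r by auto
  have "(4 * riem_hh x * riem_kk x - (riem_hk x)\<^sup>2) / (3 * weyl_coeff x) = (3 * (weyl_term x)\<^sup>2
      + 2 * \<Lambda> * weyl_term x - (charge_term x)\<^sup>2) / (3 * weyl_term x)"
    by (simp add: coefficients[OF x]) (simp add: power2_eq_square field_simps)
  also have "\<dots> = (3 * (weyl_term x)\<^sup>2 + 2 * \<Lambda> * weyl_term x
      - (charge_term x)\<^sup>2) * ((x $ 2) ^ 4)\<^sup>2 / (3 * (x $ 2) ^ 4 * (weyl_term x * (x $ 2) ^ 4))"
    using w0 r by (simp add: field_simps power2_eq_square)
  also have "(3 * (weyl_term x)\<^sup>2 + 2 * \<Lambda> * weyl_term x - (charge_term x)\<^sup>2) * ((x $ 2) ^ 4)\<^sup>2 =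
    3 * (weyl_term x * (x $ 2) ^ 4)\<^sup>2 + 2 * \<Lambda> * (x $ 2) ^ 4 * (weyl_term x * (x $ 2) ^ 4)
        - (charge_term x * (x $ 2) ^ 4)\<^sup>2"
    by (simp add: power2_eq_square algebra_simps)
  finally show ?thesis
    unfolding w u by (simp add: algebra_simps power2_eq_square power4_eq_xxxx eval_nat_numeral)
qed

lemma weyl_coeff_ne_0: "x \<in> vbds_domain m q I \<Longrightarrow> weyl_coeff x \<noteq> 0"
  using ne_domain[of x] domain_subset U_D(2)[of x] by (auto simp: coefficients weyl_term_def subset_iff)

end

theorem theorem3p1:
  fixes m q :: "real \<Rightarrow> real" and \<Lambda> :: real and I :: "real set"
    and g :: "4 tensor2" and M :: "(real^4) set"
  assumes "open I" and "smooth_real_on I m" and "smooth_real_on I q"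
    and g: "g = vbds_metric m q \<Lambda>"
    and M: "M = vbds_domain m q I"
  shows
    "(\<forall>x\<in>M. \<forall>a b c d k l. let r = x $ 2; mt = m (x $ 1); qt = q (x $ 1) in
       curv_dot g (weyl g) (weyl g) x a b c d k l
         = - ((r * mt - qt\<^sup>2) / r^4) * tachibana g (weyl g) x a b c d k l)
     \<and> (\<forall>x\<in>M. \<forall>a b c d k l. let r = x $ 2; mt = m (x $ 1); qt = q (x $ 1) in
       curv_dot g (weyl g) (conharmonic g) x a b c d k l
         = - ((r * mt - qt\<^sup>2) / r^4) * tachibana g (conharmonic g) x a b c d k l)
     \<and> (\<forall>x\<in>M. \<forall>a b c d k l. let r = x $ 2; mt = m (x $ 1); qt = q (x $ 1) in
       curv_dot g (conharmonic g) (weyl g) x a b c d k l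
         = - ((2 * r^4 * \<Lambda> + 3 * r * mt - 3 * qt\<^sup>2) / (3 * r^4))
             * tachibana g (weyl g) x a b c d k l)
     \<and> (\<forall>x\<in>M. \<forall>a b c d k l. let r = x $ 2; mt = m (x $ 1); qt = q (x $ 1) in
       curv_dot g (conharmonic g) (conharmonic g) x a b c d k l
         = - ((2 * r^4 * \<Lambda> + 3 * r * mt - 3 * qt\<^sup>2) / (3 * r^4))
             * tachibana g (conharmonic g) x a b c d k l)
     \<and> (\<forall>x\<in>M. \<forall>a b c d k l. let r = x $ 2; mt = m (x $ 1); qt = q (x $ 1);
         \<beta> = (2 * r^5 * \<Lambda> * mt + 3 * r\<^sup>2 * mt\<^sup>2 - 2 * r^4 * \<Lambda> * qt\<^sup>2 - 6 * r * mt * qt\<^sup>2 + 2 * qt^4)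
               / (3 * r^4 * (r * mt - qt\<^sup>2)) in
       curv_dot g (riemann g) (riemann g) x a b c d k l + \<beta> * tachibana g (weyl g) x a b c d k l
         = tachibana (ricci g) (riemann g) x a b c d k l)
     \<and> conformal_2forms_recurrent_on M g (\<lambda>x i.
       let t = x $ 1; r = x $ 2; mt = m t; qt = q t in
       if i = 1 then (r * deriv m t - deriv (\<lambda>u. (q u)\<^sup>2) t) / (r * mt - qt\<^sup>2)
       else if i = 2 then qt\<^sup>2 / (r\<^sup>2 * mt - r * qt\<^sup>2)
       else 0)
     \<and> generalized_roter_on {x \<in> M. q (x $ 1) \<noteq> 0} g
     \<and> einstein_level_on 3 M g
     \<and> compatible_on M g (ricci g) (riemann g)
     \<and> compatible_on M g (ricci g) (projective g)
     \<and> compatible_on M g (ricci g) (concircular g)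
     \<and> compatible_on M g (ricci g) (conharmonic g)
     \<and> compatible_on M g (ricci g) (weyl g)"
proof -
  interpret vbds I m q \<Lambda>
    using assms(1-3) by unfold_locales
  \<comment> \<open>The variable \<open>g\<close> of the theorem hides the constant of the locale,
    hence the qualified name.\<close>
  have g': "g = radiating_metric.g f_A"
    using g_eq g by simp
  have MU: "\<And>x. x \<in> M \<Longrightarrow> x \<in> U" and MS: "M \<subseteq> U"
    using domain_subset M by auto
  show ?thesis
    unfolding Let_def
  proof (intro conjI ballI allI)
    fix x a b c d k l assume x: "x \<in> M"
    note x' = MU[OF x]
    show "curv_dot g (riemann g) (riemann g) x a b c d k l
      + (2 * (x $ 2) ^ 5 * \<Lambda> * m (x $ 1) + 3 * (x $ 2)\<^sup>2 * (m (x $ 1))\<^sup>2 - 2 * (x $ 2) ^ 4 * \<Lambda> * (q (x $ 1))\<^sup>2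
          - 6 * x $ 2 * m (x $ 1) * (q (x $ 1))\<^sup>2 + 2 * q (x $ 1) ^ 4)
        / (3 * (x $ 2) ^ 4 * (x $ 2 * m (x $ 1) - (q (x $ 1))\<^sup>2)) * tachibana g (weyl g) x a b c d k l
      = tachibana (ricci g) (riemann g) x a b c d k l"
      \<comment> \<open>This is where q^2 - rm being nonzero permits the division by
        \<open>weyl_coeff\<close>.\<close>
      using curv_dot_riemann[OF x' weyl_coeff_ne_0] riemann_factor x unfolding g' M by simp
  qed (unfold g', simp_all only: weyl_dot[OF MU] conharmonic_dot[OF MU],
      use conformal_recurrent generalized_roter einstein_level compatible_riemann compatible_projective
        compatible_concircular compatible_conharmonic compatible_weyl
        in \<open>auto simp: M Let_def intro: compatible_on_subset[OF _ domain_subset]\<close>)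
qed

end
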